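(* Let $B\in\mathbb{R}^{m\times n}$ have full column rank and unit-norm columns, with $m>n$, and let $B=QR$ be its thin QR factorization. Put $P_Q^\perp=I-QQ^T$. Let $X\in\operatorname{range}(P_Q^\perp)$ be a fixed vector, let $\sigma>0$, let $Y\sim N(0,\sigma^2I_m)$, and define $$q=\frac{X+Y}{\|X+Y\|_2}.$$ Then, for every $0<\tau<1$, if $\|P_Q^\perp q\|_2\ge\tau$, then $$\kappa([B,q])\le \kappa(B)\,\frac{1+\sqrt{1-\tau^2}}{\tau}.$$ Moreover, $$\mathbb P(\|P_Q^\perp q\|_2\ge\tau)=1-F'_{m-n,n}\left(\frac{n\tau^2}{(m-n)(1-\tau^2)};\frac{\|X\|_2^2}{\sigma^2}\right).$$
   Context: For a real matrix $A$, $\kappa(A)=\sigma_{\max}(A)/\sigma_{\min}(A)$ is the spectral condition number (ratio of largest to smallest singular value). $[B,q]$ is the $m\times(n+1)$ matrix obtained by appending the column $q$ to $B$. In the thin QR factorization $B=QR$, $Q\in\mathbb{R}^{m\times n}$ satisfies $Q^TQ=I_n$ and $R\in\mathbb{R}^{n\times n}$ is upper triangular. $N(0,\sigma^2I_m)$ is the centered Gaussian distribution on $\mathbb{R}^m$ with covariance $\sigma^2I_m$; $X+Y\ne0$ almost surely. $F'_{d_1,d_2}(\cdot;\lambda)$ is the CDF of the noncentral $F$-distribution with numerator degrees of freedom $d_1$, denominator degrees of freedom $d_2$, and numerator noncentrality parameter $\lambda$, i.e. the distribution of $\frac{U/d_1}{V/d_2}$ with $U,V$ independent, $U$ noncentral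 chi-square with $d_1$ degrees of freedom and noncentrality $\lambda$ (the law of $\|\mu+Z\|_2^2$ with $Z\sim N(0,I_{d_1})$, $\|\mu\|_2^2=\lambda$), and $V$ (central) chi-square with $d_2$ degrees of freedom. *)

theory Defs
  imports "HOL-Probability.Probability"
begin

definition thin_qr ::
    "((real, 'n::{finite,linorder}) vec, 'm) vec \<Rightarrow> ((real, 'n) vec, 'm::finite) vec
      \<Rightarrow> ((real, 'n) vec, 'n) vec \<Rightarrow> bool" where
  "thin_qr B Q R \<longleftrightarrow>
     transpose Q ** Q = mat 1 \<and> (\<forall>i j. j < i \<longrightarrow> R $ i $ j = 0) \<and> B = Q ** R"

text \<open>
  Requiring both a left and a right singular vector gives exactly the min(m, n) singular
  values of an m-by-n matrix: 0 is not counted when only the shape of the matrix, and not a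
  rank deficiency, produces a kernel vector.
\<close>

definition singular_values :: "real^'n^'m \<Rightarrow> real set" where
  "singular_values A =
     {s. 0 \<le> s \<and> (\<exists>u v. norm u = 1 \<and> norm v = 1 \<and> A *v v = s *\<^sub>R u \<and> transpose A *v u = s *\<^sub>R v)}"

text \<open>
  Extended-real valued: a rank-deficient matrix has condition number \<open>\<infinity>\<close>, so that an upper
  bound on the condition number is never satisfied through division by zero.
\<close>

definition cond_number :: "real^'n^'m \<Rightarrow> ereal" where
  "cond_number A =
     (if Min (singular_values A) = 0 then \<infinity>
      else ereal (Max (singular_values A) / Min (singular_values A)))"

text \<open>The n + 1 columns are indexed by \<open>'n + unit\<close>; the index \<open>Inr ()\<close> is the appended column.\<close>

definition append_column :: "real^'n^'m \<Rightarrow> real^'m \<Rightarrow> real^('n + unit)^'m" where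
  "append_column B q = (\<chi> i j. case j of Inl k \<Rightarrow> B $ i $ k | Inr _ \<Rightarrow> q $ i)"

text \<open>Density of \<open>N(0, \<sigma>\<^sup>2 I)\<close>; \<open>\<sigma>\<close> is the standard deviation.\<close>

definition isotropic_normal_density :: "real \<Rightarrow> real^'m \<Rightarrow> real" where
  "isotropic_normal_density \<sigma> y =
     exp (- (norm y)\<^sup>2 / (2 * \<sigma>\<^sup>2)) / sqrt ((2 * pi * \<sigma>\<^sup>2) ^ CARD('m))"

text \<open>\<open>N(0, I)\<close> in dimension \<open>d\<close>, the vectors being functions on \<open>{..<d}\<close>.\<close>

definition std_normal_vector :: "nat \<Rightarrow> (nat \<Rightarrow> real) measure" where
  "std_normal_vector d = (\<Pi>\<^sub>M i\<in>{..<d}. density lborel std_normal_density)"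

text \<open>
  The law of the squared norm of \<open>\<mu> + Z\<close> with \<open>Z \<sim> N(0, I)\<close>. By rotation invariance it depends on
  \<open>\<mu>\<close> only through its squared norm \<open>nc\<close>, so \<open>\<mu>\<close> is taken to be \<open>sqrt nc\<close> times the first unit
  vector. The definition is meant for \<open>d \<ge> 1\<close> and \<open>nc \<ge> 0\<close>.
\<close>

definition noncentral_chi_square :: "nat \<Rightarrow> real \<Rightarrow> real measure" where
  "noncentral_chi_square d nc =
     distr (std_normal_vector d) borel
       (\<lambda>z. \<Sum>i<d. ((if i = 0 then sqrt nc else 0) + z i)\<^sup>2)"

definition chi_square :: "nat \<Rightarrow> real measure" where
  "chi_square d = distr (std_normal_vector d) borel (\<lambda>z. \<Sum>i<d. (z i)\<^sup>2)"

definition noncentral_F :: "nat \<Rightarrow> nat \<Rightarrow> real \<Rightarrow> real measure" where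
  "noncentral_F d1 d2 nc =
     distr (noncentral_chi_square d1 nc \<Otimes>\<^sub>M chi_square d2) borel
       (\<lambda>(u, v). (u / real d1) / (v / real d2))"

end

theory Submission
  imports Defs
begin

text \<open>
  A vector of \<open>range B\<close> has the form \<open>w = Q z\<close>, and \<open>\<bar>w \<bullet> q\<bar> \<le> norm (Q\<^sup>T q) * norm w\<close> with
  \<open>norm (Q\<^sup>T q) \<le> k = sqrt (1 - \<tau>\<^sup>2)\<close>, so \<open>norm (w + t q)\<^sup>2\<close> lies between \<open>1 - k\<close> and \<open>1 + k\<close> times
  \<open>norm w\<^sup>2 + t\<^sup>2\<close>. The columns of \<open>B\<close> being unit vectors, its extreme singular values surround 1 and
  hence also control the coefficient \<open>t\<close>; finally \<open>sqrt ((1 + k) / (1 - k)) = (1 + k) / \<tau>\<close>.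

  For the probability, expand \<open>X + Y\<close> in an orthonormal basis that starts with the direction of \<open>X\<close>
  and ends with the columns of \<open>Q\<close>. Up to the factor \<open>\<sigma>\<close> its coordinates are independent standard
  normal, except that the first is shifted by \<open>norm X / \<sigma>\<close>. The squared norms of the components in
  \<open>range P\<close> and \<open>range Q\<close> are therefore \<open>\<sigma>\<^sup>2 U\<close> and \<open>\<sigma>\<^sup>2 V\<close> with \<open>U\<close> noncentral chi-square and \<open>V\<close> an
  independent chi-square, and the event is \<open>\<tau>\<^sup>2 (U + V) \<le> U\<close>.
\<close>

section \<open>Singular values and the condition number\<close>

lemma inner_transpose_matrix_vector:
  fixes A :: "real^'n^'m"
  shows "(transpose A *v u) \<bullet> x = u \<bullet> (A *v x)"
  by (simp add: dot_lmul_matrix)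

text \<open>Trades the left vector \<open>u\<close> for the eigenvector equation of the Gram matrix,
  so that the arguments below deal with the right vector \<open>v\<close> alone.\<close>

lemma singular_valuesE:
  fixes A :: "real^'n^'m"
  assumes "s \<in> singular_values A"
  obtains v where "norm v = 1" "norm (A *v v) = s" "transpose A *v (A *v v) = s\<^sup>2 *\<^sub>R v"
proof -
  from assms obtain u v where *: "0 \<le> s" "norm u = 1" "norm v = 1" "A *v v = s *\<^sub>R u"
      "transpose A *v u = s *\<^sub>R v"
    unfolding singular_values_def by blast
  have "transpose A *v (A *v v) = s *\<^sub>R (transpose A *v u)"
    unfolding *(4) by (simp only: matrix_vector_mult_scaleR)
  with * show thesis by (intro that[of v]) (auto simp: power2_eq_square)
qed

text \<open>Right singular vectors for distinct singular values are eigenvectors of the symmetric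
  Gram matrix for distinct eigenvalues, hence orthogonal, and an orthogonal family is finite.
  Finiteness gives \<open>Min\<close> and \<open>Max\<close> in \<open>cond_number\<close> their
  intended meaning.\<close>

lemma finite_singular_values:
  fixes A :: "real^'n^'m"
  shows "finite (singular_values A)"
proof -
  define f where "f s = (SOME v. norm v = 1 \<and> norm (A *v v) = s
    \<and> transpose A *v (A *v v) = s\<^sup>2 *\<^sub>R v)" for s
  have f: "norm (f s) = 1 \<and> norm (A *v f s) = s \<and> transpose A *v (A *v f s) = s\<^sup>2 *\<^sub>R f s"
    if "s \<in> singular_values A" for s
    unfolding f_def by (rule someI_ex) (use singular_valuesE[OF that] in blast)
  \<comment> \<open>The vector determines its singular value, since
    \<open>s = norm (A *v f s)\<close>.\<close>
  have inj: "inj_on f (singular_values A)"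
    by (rule inj_onI) (metis f)
  have "pairwise orthogonal (f ` singular_values A)"
  proof (rule pairwiseI, clarify)
    fix s t assume st: "s \<in> singular_values A" "t \<in> singular_values A" "f s \<noteq> f t"
    have "s\<^sup>2 * (f s \<bullet> f t) = (A *v f s) \<bullet> (A *v f t)"
      using f[OF st(1)] inner_transpose_matrix_vector[of A "A *v f s" "f t"] by simp
    also have "\<dots> = t\<^sup>2 * (f s \<bullet> f t)"
      using f[OF st(2)] inner_transpose_matrix_vector[of A "A *v f t" "f s"]
      by (simp add: inner_commute)
    finally have "s\<^sup>2 = t\<^sup>2 \<or> f s \<bullet> f t = 0" by auto
    moreover have "0 \<le> s" "0 \<le> t" using f st by (metis norm_ge_zero)+
    ultimately show "orthogonal (f s) (f t)"
      using st(3) by (auto simp: orthogonal_def)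
  qed
  hence "finite (f ` singular_values A)" by (rule pairwise_orthogonal_imp_finite)
  with inj show ?thesis by (rule finite_imageD[rotated])
qed

text \<open>The gradient of a semidefinite quadratic form vanishes at its zeros.\<close>

lemma extremal_imp_eigenvector:
  fixes A :: "real^'n^'m"
  assumes nonneg: "\<And>x. 0 \<le> \<epsilon> * (c * (norm x)\<^sup>2 - (norm (A *v x))\<^sup>2)"
    and zero: "(norm (A *v v))\<^sup>2 = c * (norm v)\<^sup>2" and "\<epsilon> \<noteq> 0"
  shows "transpose A *v (A *v v) = c *\<^sub>R v"
proof -
  define F where "F x = \<epsilon> * (c * (norm x)\<^sup>2 - (norm (A *v x))\<^sup>2)" for x
  \<comment> \<open>\<open>w\<close> is half the gradient of \<open>F\<close> at its zero
    \<open>v\<close>. A step \<open>t\<close> against it, with \<open>F w + 1\<close> as a positive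
    denominator, gives \<open>F\<close> the value
    \<open>- (w \<bullet> w)\<^sup>2 * (F w + 2) / (F w + 1)\<^sup>2\<close>, which is negative
    unless \<open>w = 0\<close>.\<close>
  define w where "w = \<epsilon> *\<^sub>R (c *\<^sub>R v - transpose A *v (A *v v))"
  have Fw: "F w \<ge> 0" using nonneg by (simp add: F_def)
  define t where "t = - (w \<bullet> w) / (F w + 1)"
  have ww: "w \<bullet> w = \<epsilon> * (c * (v \<bullet> w) - (A *v v) \<bullet> (A *v w))"
    using inner_transpose_matrix_vector[of A "A *v v" w]
    by (subst (1) w_def) (simp add: inner_diff_left)
  have "F (v + t *\<^sub>R w) = F v + 2 * t * (\<epsilon> * (c * (v \<bullet> w) - (A *v v) \<bullet> (A *v w))) + t\<^sup>2 * F w"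
    unfolding F_def power2_norm_eq_inner
    by (simp add: matrix_vector_right_distrib matrix_vector_mult_scaleR inner_add_left
        inner_add_right inner_commute algebra_simps power2_eq_square)
  hence eq: "F (v + t *\<^sub>R w) = 2 * t * (w \<bullet> w) + t\<^sup>2 * F w"
    using zero by (simp add: F_def flip: ww)
  have "0 \<le> (2 * t * (w \<bullet> w) + t\<^sup>2 * F w) * (F w + 1)\<^sup>2"
    using nonneg[of "v + t *\<^sub>R w"] eq by (simp add: F_def)
  also have "\<dots> = 2 * (t * (F w + 1)) * (F w + 1) * (w \<bullet> w) + (t * (F w + 1))\<^sup>2 * F w"
    by (simp add: algebra_simps power2_eq_square)
  also have "t * (F w + 1) = - (w \<bullet> w)" using Fw by (simp add: t_def)
  finally have "(w \<bullet> w)\<^sup>2 * (F w + 2) \<le> 0"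
    by (simp add: algebra_simps power2_eq_square)
  hence "w = 0" using Fw by (simp add: mult_le_0_iff)
  thus ?thesis using \<open>\<epsilon> \<noteq> 0\<close> by (simp add: w_def)
qed

text \<open>The left vector is recovered as \<open>A *v v\<close> divided by \<open>s\<close>, which
  is where positivity of \<open>s\<close> enters. For \<open>s = 0\<close> a kernel vector of the
  transpose would have to be found separately.\<close>

lemma singular_valueI:
  fixes A :: "real^'n^'m"
  assumes "transpose A *v (A *v v) = s\<^sup>2 *\<^sub>R v" "norm v = 1" "0 < s"
  shows "s \<in> singular_values A"
proof -
  have "(norm (A *v v))\<^sup>2 = s\<^sup>2"
    using inner_transpose_matrix_vector[of A "A *v v" v] assms
    by (simp add: power2_norm_eq_inner flip: power2_norm_eq_inner)
  hence n: "norm (A *v v) = s" using assms(3) by (simp add: power2_eq_iff_nonneg)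
  show ?thesis unfolding singular_values_def
    by (rule CollectI, intro conjI exI[of _ "(1/s) *\<^sub>R (A *v v)"] exI[of _ v])
       (use assms n in \<open>auto simp: matrix_vector_mult_scaleR power2_eq_square
         simp del: transpose_matrix_vector\<close>)
qed

section \<open>Extreme singular values by compactness\<close>

lemma norm_matrix_vector_homogeneous:
  fixes A :: "real^'n^'m"
  assumes "x \<noteq> 0"
  shows "norm (A *v x) = norm x * norm (A *v ((1 / norm x) *\<^sub>R x))"
  using assms by (simp add: matrix_vector_mult_scaleR)

text \<open>The maximum of \<open>norm (A *v x)\<close> over the compact unit sphere is attained,
  and by homogeneity it bounds \<open>A\<close> everywhere. The maximiser is a zero of a
  semidefinite form, hence a singular vector. The hypothesis rules out \<open>A = 0\<close>, so the
  maximum is positive.\<close>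

lemma largest_singular_value:
  fixes A :: "real^'n^'m"
  assumes "A *v z \<noteq> 0"
  obtains s where "s \<in> singular_values A" "\<And>x. norm (A *v x) \<le> s * norm x"
proof -
  have cont: "continuous_on (sphere 0 1) (\<lambda>x. norm (A *v x))"
    by (intro continuous_on_norm linear_continuous_on) simp
  have "sphere (0::real^'n) 1 \<noteq> {}" by simp
  with cont obtain v where v: "norm v = 1" "\<And>x. norm x = 1 \<Longrightarrow> norm (A *v x) \<le> norm (A *v v)"
    using continuous_attains_sup[of "sphere (0::real^'n) 1" "\<lambda>x. norm (A *v x)"]
    by auto
  let ?s = "norm (A *v v)"
  have le: "norm (A *v x) \<le> ?s * norm x" for x
  proof (cases "x = 0")
    case False
    hence "norm (A *v ((1 / norm x) *\<^sub>R x)) \<le> ?s" by (intro v(2)) simp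
    thus ?thesis
      unfolding norm_matrix_vector_homogeneous[OF False]
      by (metis mult.commute mult_left_mono norm_ge_zero)
  qed simp
  have "(norm (A *v x))\<^sup>2 \<le> ?s\<^sup>2 * (norm x)\<^sup>2" for x
    using power_mono[OF le[of x], of 2] by (simp add: power_mult_distrib)
  hence eig: "transpose A *v (A *v v) = ?s\<^sup>2 *\<^sub>R v"
    using v(1) by (intro extremal_imp_eigenvector[where \<epsilon> = 1]) auto
  have "?s \<noteq> 0"
  proof
    assume "?s = 0"
    hence "norm (A *v z) \<le> 0" using le[of z] by (simp only: mult_zero_left)
    thus False using assms by simp
  qed
  hence "0 < ?s" by simp
  from singular_valueI[OF eig v(1) this] le show thesis by (rule that)
qed

text \<open>Dual to the previous argument: a minimiser on the sphere, the opposite sign of the form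
  (\<open>\<epsilon> = -1\<close>), and injectivity to make the minimum positive.\<close>

lemma smallest_singular_value:
  fixes A :: "real^'n^'m"
  assumes "inj ((*v) A)"
  obtains s where "s \<in> singular_values A" "0 < s" "\<And>x. s * norm x \<le> norm (A *v x)"
proof -
  have cont: "continuous_on (sphere 0 1) (\<lambda>x. norm (A *v x))"
    by (intro continuous_on_norm linear_continuous_on) simp
  have "sphere (0::real^'n) 1 \<noteq> {}" by simp
  with cont obtain v where v: "norm v = 1" "\<And>x. norm x = 1 \<Longrightarrow> norm (A *v v) \<le> norm (A *v x)"
    using continuous_attains_inf[of "sphere (0::real^'n) 1" "\<lambda>x. norm (A *v x)"]
    by auto
  let ?s = "norm (A *v v)"
  have le: "?s * norm x \<le> norm (A *v x)" for x
  proof (cases "x = 0")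
    case False
    hence "?s \<le> norm (A *v ((1 / norm x) *\<^sub>R x))" by (intro v(2)) simp
    thus ?thesis
      unfolding norm_matrix_vector_homogeneous[OF False]
      by (metis mult.commute mult_left_mono norm_ge_zero)
  qed simp
  have "?s\<^sup>2 * (norm x)\<^sup>2 \<le> (norm (A *v x))\<^sup>2" for x
    using power_mono[OF le[of x], of 2] by (simp add: power_mult_distrib)
  hence eig: "transpose A *v (A *v v) = ?s\<^sup>2 *\<^sub>R v"
    using v(1) by (intro extremal_imp_eigenvector[where \<epsilon> = "-1"]) auto
  have "v \<noteq> 0" using v(1) by auto
  hence "A *v v \<noteq> 0" using assms by (metis injD matrix_vector_mult_0_right)
  hence "0 < ?s" by simp
  from singular_valueI[OF eig v(1) this] this le show thesis by (rule that)
qed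

text \<open>The two bounds confine every singular value to the interval from \<open>l\<close> to
  \<open>L\<close>. The lower one also gives injectivity, hence the existence of a singular value,
  and keeps the minimum away from 0, so the infinite branch of \<open>cond_number\<close> is
  excluded.\<close>

lemma cond_number_le:
  fixes A :: "real^'n^'m"
  assumes "0 < l" and bounds: "\<And>x. l * norm x \<le> norm (A *v x)" "\<And>x. norm (A *v x) \<le> L * norm x"
  shows "cond_number A \<le> ereal (L / l)"
proof -
  have inj: "inj ((*v) A)"
  proof (rule injI)
    fix x y assume "A *v x = A *v y"
    hence "l * norm (x - y) \<le> 0" using bounds(1)[of "x - y"]
      by (simp add: matrix_vector_mult_diff_distrib)
    thus "x = y" using \<open>0 < l\<close> by (simp add: mult_le_0_iff)
  qed
  have between: "l \<le> s \<and> s \<le> L" if s: "s \<in> singular_values A" for s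
    by (rule singular_valuesE[OF s]) (use bounds in \<open>metis mult.right_neutral\<close>)
  have ne: "singular_values A \<noteq> {}" using smallest_singular_value[OF inj] by blast
  note fin = finite_singular_values[of A]
  have 1: "l \<le> Min (singular_values A)" using Min_in[OF fin ne] between by blast
  have 2: "Max (singular_values A) \<le> L" using Max_in[OF fin ne] between by blast
  have 3: "l \<le> Max (singular_values A)" using Max_in[OF fin ne] between by blast
  show ?thesis using 1 2 3 \<open>0 < l\<close> by (auto simp: cond_number_def intro!: frac_le)
qed

text \<open>Counterpart of \<open>cond_number_le\<close>: the extreme singular values are themselves
  admissible bounds, so condition numbers can be compared through norm inequalities only.\<close>

lemma cond_number_attained:
  fixes A :: "real^'n^'m"
  assumes inj: "inj ((*v) A)"
  obtains l L where "0 < l" "\<And>x. l * norm x \<le> norm (A *v x)" "\<And>x. norm (A *v x) \<le> L * norm x"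
    "cond_number A = ereal (L / l)"
proof -
  obtain l where l: "l \<in> singular_values A" "0 < l" "\<And>x. l * norm x \<le> norm (A *v x)"
    using smallest_singular_value[OF inj] by blast
  have "A *v axis undefined 1 \<noteq> 0"
    using inj by (metis injD matrix_vector_mult_0_right axis_eq_0_iff zero_neq_one)
  then obtain L where L: "L \<in> singular_values A" "\<And>x. norm (A *v x) \<le> L * norm x"
    using largest_singular_value by blast
  have between: "l \<le> s \<and> s \<le> L" if s: "s \<in> singular_values A" for s
    by (rule singular_valuesE[OF s]) (use l(3) L(2) in \<open>metis mult.right_neutral\<close>)
  note fin = finite_singular_values[of A]
  have "Min (singular_values A) = l" using l between by (intro Min_eqI fin) auto
  moreover have "Max (singular_values A) = L" using L between by (intro Max_eqI fin) auto
  ultimately have "cond_number A = ereal (L / l)" using l(2) by (simp add: cond_number_def)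
  with l L show thesis by (intro that) auto
qed

section \<open>The matrix with an appended column\<close>

lemma sum_UNIV_Plus_unit:
  fixes f :: "'n::finite + unit \<Rightarrow> 'a::comm_monoid_add"
  shows "sum f UNIV = (\<Sum>k\<in>UNIV. f (Inl k)) + f (Inr ())"
  by (simp add: UNIV_Plus_UNIV[symmetric] sum.Plus UNIV_unit del: UNIV_Plus_UNIV)

lemma append_column_mult:
  "append_column B q *v x = B *v (\<chi> k. x $ Inl k) + x $ Inr () *\<^sub>R q"
  by (simp add: vec_eq_iff matrix_vector_mult_def sum_UNIV_Plus_unit append_column_def)

lemma norm_vec_Plus_unit:
  fixes x :: "real^('n::finite + unit)"
  shows "(norm x)\<^sup>2 = (norm (\<chi> k. x $ Inl k))\<^sup>2 + (x $ Inr ())\<^sup>2"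
  unfolding power2_norm_eq_inner inner_vec_def sum_UNIV_Plus_unit
  by (simp add: power2_eq_square)

text \<open>The last hypothesis on \<open>\<tau>\<close> is the Pythagorean form of the lower bound
  on the component of \<open>q\<close> orthogonal to the columns of \<open>Q\<close>; it limits the
  component inside their span.\<close>

lemma cond_number_append_column_le:
  fixes B Q :: "((real, 'n::{finite,linorder}) vec, 'm::finite) vec"
  assumes rank: "rank B = CARD('n)" and unit: "\<And>j. norm (column j B) = 1"
    and qr: "thin_qr B Q R" and q: "norm q = 1"
    and \<tau>: "0 < \<tau>" "\<tau> < 1" "\<tau>\<^sup>2 + (norm (transpose Q *v q))\<^sup>2 \<le> 1"
  shows "cond_number (append_column B q) \<le> cond_number B * ereal ((1 + sqrt (1 - \<tau>\<^sup>2)) / \<tau>)"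
proof -
  have "inj ((*v) B)" using rank by (simp add: full_rank_injective)
  then obtain l L where l: "0 < l" "\<And>x. l * norm x \<le> norm (B *v x)"
    and L: "\<And>x. norm (B *v x) \<le> L * norm x" and cond: "cond_number B = ereal (L / l)"
    using cond_number_attained by blast
  \<comment> \<open>A basis vector is mapped to a unit column, which places 1 between
    \<open>l\<close> and \<open>L\<close>.\<close>
  have "norm (B *v axis j 1) = 1" for j using unit by (simp add: matrix_vector_mult_basis)
  hence l1: "l \<le> 1" and L1: "1 \<le> L"
    using l(2)[of "axis undefined 1"] L[of "axis undefined 1"] by simp_all
  \<comment> \<open>\<open>k\<close> bounds the cosine of the angle between \<open>q\<close> and the
    range of \<open>B\<close>.\<close>
  define k where "k = sqrt (1 - \<tau>\<^sup>2)"
  have \<tau>2: "0 < \<tau>\<^sup>2" "\<tau>\<^sup>2 < 1" using \<tau> by (simp_all add: power_less_one_iff abs_square_less_1)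
  have k: "0 \<le> k" "k < 1" "k\<^sup>2 = 1 - \<tau>\<^sup>2" using \<tau>2 by (simp_all add: k_def)
  have c: "norm (transpose Q *v q) \<le> k"
    using \<tau>(3) k by (intro power2_le_imp_le[OF _ k(1)]) simp
  have QQ: "norm (Q *v z) = norm z" for z
  proof -
    have "(Q *v z) \<bullet> (Q *v z) = (transpose Q *v (Q *v z)) \<bullet> z"
      by (simp only: inner_transpose_matrix_vector)
    also have "\<dots> = z \<bullet> z"
      using qr by (simp only: matrix_vector_mul_assoc thin_qr_def matrix_vector_mul_lid)
    finally show ?thesis by (simp add: norm_eq_sqrt_inner)
  qed
  \<comment> \<open>The mixed term of the squared norm of \<open>B *v y + t *\<^sub>R q\<close>:
    Cauchy-Schwarz in the coordinates given by \<open>Q\<close>, then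
    \<open>2 * a * b \<le> a\<^sup>2 + b\<^sup>2\<close>.\<close>
  have cross: "\<bar>2 * t * ((B *v y) \<bullet> q)\<bar> \<le> k * ((norm (B *v y))\<^sup>2 + t\<^sup>2)" for y t
  proof -
    have By: "B *v y = Q *v (R *v y)" using qr by (simp add: thin_qr_def matrix_vector_mul_assoc)
    have "\<bar>(B *v y) \<bullet> q\<bar> = \<bar>(transpose Q *v q) \<bullet> (R *v y)\<bar>"
      unfolding inner_transpose_matrix_vector By by (simp add: inner_commute)
    also have "\<dots> \<le> norm (transpose Q *v q) * norm (R *v y)" by (rule Cauchy_Schwarz_ineq2)
    also have "\<dots> \<le> k * norm (B *v y)" using c by (simp only: By QQ mult_right_mono norm_ge_zero)
    finally have "2 * \<bar>t\<bar> * \<bar>(B *v y) \<bullet> q\<bar> \<le> 2 * \<bar>t\<bar> * (k * norm (B *v y))"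
      by (intro mult_left_mono) auto
    also have "\<dots> = k * (2 * norm (B *v y) * \<bar>t\<bar>)" by simp
    also have "\<dots> \<le> k * ((norm (B *v y))\<^sup>2 + \<bar>t\<bar>\<^sup>2)"
      by (intro mult_left_mono sum_squares_bound k)
    finally show ?thesis by (simp add: abs_mult)
  qed
  have lower: "sqrt (1 - k) * l * norm x \<le> norm (append_column B q *v x)"
    and upper: "norm (append_column B q *v x) \<le> sqrt (1 + k) * L * norm x" for x
  proof -
    let ?y = "\<chi> j. x $ Inl j" and ?t = "x $ Inr ()"
    let ?N = "(norm (B *v ?y))\<^sup>2 + ?t\<^sup>2"
    have eq: "(norm (append_column B q *v x))\<^sup>2 = ?N + 2 * ?t * ((B *v ?y) \<bullet> q)"
      using dot_norm[of "B *v ?y" "?t *\<^sub>R q"] q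
      by (simp add: append_column_mult power_mult_distrib)
    have "l\<^sup>2 * (norm ?y)\<^sup>2 \<le> (norm (B *v ?y))\<^sup>2"
      using power_mono[OF l(2)[of ?y], of 2] l(1) by (simp add: power_mult_distrib)
    \<comment> \<open>Because \<open>l \<le> 1\<close>, the factor that serves the block
      \<open>B\<close> also serves the appended coordinate.\<close>
    moreover have "l\<^sup>2 * ?t\<^sup>2 \<le> 1 * ?t\<^sup>2" using l(1) l1 by (intro mult_right_mono power_le_one) auto
    ultimately have "l\<^sup>2 * (norm x)\<^sup>2 \<le> ?N" by (simp add: norm_vec_Plus_unit algebra_simps)
    hence "(1 - k) * (l\<^sup>2 * (norm x)\<^sup>2) \<le> (1 - k) * ?N" using k by (intro mult_left_mono) auto
    also have "\<dots> \<le> (norm (append_column B q *v x))\<^sup>2"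
      using cross[of ?t ?y] unfolding eq by (simp add: algebra_simps)
    also have "(1 - k) * (l\<^sup>2 * (norm x)\<^sup>2) = (sqrt (1 - k) * l * norm x)\<^sup>2"
      using k by (simp add: power_mult_distrib)
    finally show "sqrt (1 - k) * l * norm x \<le> norm (append_column B q *v x)"
      by (rule power2_le_imp_le) simp
    have "(norm (B *v ?y))\<^sup>2 \<le> L\<^sup>2 * (norm ?y)\<^sup>2"
      using power_mono[OF L[of ?y], of 2] by (simp add: power_mult_distrib)
    moreover have "1 * ?t\<^sup>2 \<le> L\<^sup>2 * ?t\<^sup>2" using L1 by (intro mult_right_mono one_le_power) auto
    ultimately have "?N \<le> L\<^sup>2 * (norm x)\<^sup>2" by (simp add: norm_vec_Plus_unit algebra_simps)
    hence "(1 + k) * ?N \<le> (1 + k) * (L\<^sup>2 * (norm x)\<^sup>2)" using k by (intro mult_left_mono) auto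
    moreover have "(norm (append_column B q *v x))\<^sup>2 \<le> (1 + k) * ?N"
      using cross[of ?t ?y] unfolding eq by (simp add: algebra_simps)
    ultimately have "(norm (append_column B q *v x))\<^sup>2 \<le> (1 + k) * (L\<^sup>2 * (norm x)\<^sup>2)" by simp
    also have "(1 + k) * (L\<^sup>2 * (norm x)\<^sup>2) = (sqrt (1 + k) * L * norm x)\<^sup>2"
      using k by (simp add: power_mult_distrib)
    finally show "norm (append_column B q *v x) \<le> sqrt (1 + k) * L * norm x"
      by (rule power2_le_imp_le) (use k L1 in simp)
  qed
  have "cond_number (append_column B q) \<le> ereal (sqrt (1 + k) * L / (sqrt (1 - k) * l))"
    using k l(1) lower upper by (intro cond_number_le) auto
  also have "sqrt (1 + k) / sqrt (1 - k) = (1 + k) / \<tau>"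
  proof -
    have "(1 + k) * (1 - k) = \<tau>\<^sup>2" using k(3) by (simp add: algebra_simps power2_eq_square)
    hence "sqrt (1 + k) * sqrt (1 - k) = sqrt (\<tau>\<^sup>2)" by (metis real_sqrt_mult)
    hence "sqrt (1 + k) * sqrt (1 - k) = \<tau>" using \<tau> by simp
    moreover have "sqrt (1 + k) * sqrt (1 + k) = 1 + k" using k by simp
    ultimately have "sqrt (1 + k) * \<tau> = (1 + k) * sqrt (1 - k)" by (metis mult.assoc)
    thus ?thesis using k \<tau>(1) by (simp add: frac_eq_eq)
  qed
  hence "sqrt (1 + k) * L / (sqrt (1 - k) * l) = L / l * ((1 + k) / \<tau>)"
    by (metis mult.commute times_divide_times_eq)
  finally show ?thesis by (simp add: cond k_def)
qed

section \<open>Gaussian vectors\<close>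

text \<open>
  Uniqueness of Haar measure: for translation invariant \<open>M\<close>, shearing the double integral of
  \<open>f x * g y\<close> in each variable gives \<open>\<integral>f dM * \<integral>g d\<lambda> = \<integral>g(-x) dM * \<integral>f d\<lambda>\<close>. Here \<open>g\<close> is the
  indicator of the unit ball, which \<open>T\<close> preserves.
\<close>

lemma distr_lborel_orthogonal_transformation:
  fixes T :: "'a::euclidean_space \<Rightarrow> 'a"
  assumes T: "orthogonal_transformation T"
  shows "distr lborel borel T = lborel"
proof -
  have lin: "linear T" using T by (simp add: orthogonal_transformation_def)
  have [measurable]: "T \<in> borel_measurable borel"
    using lin by (intro borel_measurable_continuous_onI linear_continuous_on) (simp add: linear_conv_bounded_linear)
  define M where "M = distr lborel borel T"
  have sets_M [measurable_cong, simp]: "sets M = sets borel" by (simp add: M_def)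
  have shift_lborel: "(\<integral>\<^sup>+y. h (y + x) \<partial>lborel) = (\<integral>\<^sup>+y. h y \<partial>lborel)"
    if [measurable]: "h \<in> borel_measurable borel" for h and x :: 'a
    by (subst (2) lborel_distr_plus[of x, symmetric]) (simp add: nn_integral_distr add.commute)
  have shift_M: "(\<integral>\<^sup>+y. h (y + x) \<partial>M) = (\<integral>\<^sup>+y. h y \<partial>M)"
    if [measurable]: "h \<in> borel_measurable borel" for h and x :: 'a
  proof -
    \<comment> \<open>A shift by \<open>x\<close> after \<open>T\<close> is a shift by a preimage of
      \<open>x\<close> before \<open>T\<close>, where Lebesgue measure is invariant.\<close>
    obtain x' where x': "x = T x'" using orthogonal_transformation_surj[OF T] by (metis surjD)
    have "(\<integral>\<^sup>+y. h (y + x) \<partial>M) = (\<integral>\<^sup>+y. h (T (y + x')) \<partial>lborel)"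
      by (simp add: M_def nn_integral_distr x' linear_add[OF lin])
    also have "\<dots> = (\<integral>\<^sup>+y. h (T y) \<partial>lborel)" by (rule shift_lborel) measurable
    finally show ?thesis by (simp add: M_def nn_integral_distr)
  qed
  let ?B = "ball (0::'a) 1"
  have [measurable]: "?B \<in> sets borel" by simp
  have "T -` ?B = ?B" using T by (auto simp: orthogonal_transformation_norm)
  hence ball_M: "emeasure M ?B = emeasure lborel ?B" by (simp add: M_def emeasure_distr)
  have fin: "emeasure lborel ?B < \<infinity>" using emeasure_lborel_ball_finite by blast
  have pos: "0 < emeasure lborel ?B" by (simp add: emeasure_ball)
  interpret L: sigma_finite_measure "lborel :: 'a measure" by (rule sigma_finite_lborel)
  \<comment> \<open>Fubini for \<open>M\<close> and \<open>lborel\<close> asks for this.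
    \<open>T\<close> preserves centered balls, so these have finite \<open>M\<close>-measure and
    exhaust the space.\<close>
  have "sigma_finite_measure M"
  proof (rule sigma_finite_measure.intro, intro exI conjI)
    show "countable (range (\<lambda>n. ball (0::'a) (real n)))" by simp
    show "range (\<lambda>n. ball (0::'a) (real n)) \<subseteq> sets M" by auto
    show "\<Union> (range (\<lambda>n. ball (0::'a) (real n))) = space M"
      by (auto simp: M_def intro: reals_Archimedean2)
    have "T -` ball 0 r = ball 0 r" for r
      using T by (auto simp: orthogonal_transformation_norm)
    thus "\<forall>a\<in>range (\<lambda>n. ball (0::'a) (real n)). emeasure M a \<noteq> \<infinity>"
      using emeasure_lborel_ball_finite by (auto simp: M_def emeasure_distr less_top)
  qed
  then interpret M: sigma_finite_measure M .
  interpret P: pair_sigma_finite M "lborel :: 'a measure" ..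
  have "M = lborel"
  proof (rule measure_eqI)
    fix A assume "A \<in> sets M"
    hence [measurable]: "A \<in> sets borel" by simp
    have "emeasure M A * emeasure lborel ?B
        = (\<integral>\<^sup>+x. (\<integral>\<^sup>+y. indicator A x * indicator ?B y \<partial>lborel) \<partial>M)"
      by (simp add: nn_integral_cmult_indicator nn_integral_multc)
    also have "\<dots> = (\<integral>\<^sup>+x. (\<integral>\<^sup>+y. indicator A x * indicator ?B (y + (- x)) \<partial>lborel) \<partial>M)"
      by (rule nn_integral_cong, rule shift_lborel[symmetric]) measurable
    also have "\<dots> = (\<integral>\<^sup>+y. (\<integral>\<^sup>+x. indicator A x * indicator ?B (y - x) \<partial>M) \<partial>lborel)"
      by (subst P.Fubini') auto
    also have "\<dots> = (\<integral>\<^sup>+y. (\<integral>\<^sup>+x. indicator A (x + y) * indicator ?B (y - (x + y)) \<partial>M) \<partial>lborel)"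
      by (subst shift_M) auto
    \<comment> \<open>Here \<open>y - (x + y)\<close> is \<open>- x\<close>, and the ball is
      symmetric about 0.\<close>
    also have "\<dots> = (\<integral>\<^sup>+x. (\<integral>\<^sup>+y. indicator A (y + x) * indicator ?B x \<partial>lborel) \<partial>M)"
      by (subst P.Fubini') (auto simp: indicator_def add.commute)
    also have "\<dots> = (\<integral>\<^sup>+x. (\<integral>\<^sup>+y. indicator A y * indicator ?B x \<partial>lborel) \<partial>M)"
      by (subst shift_lborel[of "\<lambda>y. indicator A y * indicator ?B _"]) auto
    also have "\<dots> = emeasure lborel A * emeasure lborel ?B"
      by (simp add: nn_integral_multc nn_integral_cmult_indicator ball_M)
    finally show "emeasure M A = emeasure lborel A"
      using fin pos unfolding mult.commute[of _ "emeasure lborel ?B"] ennreal_mult_cancel_left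
      by auto
  qed (simp add: M_def)
  thus ?thesis by (simp add: M_def)
qed

section \<open>Splitting a standard normal vector into blocks\<close>

lemma prob_space_std_normal_vector: "prob_space (std_normal_vector d)"
  unfolding std_normal_vector_def by (intro prob_space_PiM prob_space_normal_density) simp

lemma product_sigma_finite_std_normal:
  "product_sigma_finite (\<lambda>_::'i. density lborel (\<lambda>x. ennreal (std_normal_density x)))"
  by (intro product_sigma_finite.intro prob_space_imp_sigma_finite prob_space_normal_density) simp

lemma std_normal_vector_split_measurable:
  "(\<lambda>(x, y). \<lambda>i\<in>{..<a + b}. if i < a then x i else y (i - a))
    \<in> std_normal_vector a \<Otimes>\<^sub>M std_normal_vector b \<rightarrow>\<^sub>M (\<Pi>\<^sub>M i\<in>{..<a + b}. borel)"
  unfolding std_normal_vector_def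
proof (unfold case_prod_beta, intro measurable_restrict)
  let ?N = "density lborel (\<lambda>x. ennreal (std_normal_density x))"
  fix i assume "i \<in> {..<a + b}"
  hence "i - a \<in> {..<b}" if "\<not> i < a" using that by auto
  thus "(\<lambda>p. if i < a then fst p i else snd p (i - a))
      \<in> borel_measurable (Pi\<^sub>M {..<a} (\<lambda>_. ?N) \<Otimes>\<^sub>M Pi\<^sub>M {..<b} (\<lambda>_. ?N))"
    by (cases "i < a") (auto intro!: measurable_compose[OF measurable_fst]
      measurable_compose[OF measurable_snd] measurable_PiM_component_rev)
qed

text \<open>A product measure is determined by its values on boxes, and on a box the product over
  \<open>a + b\<close> coordinates factors into the two blocks. This is the source of the
  independence of the two chi-square variables.\<close>

lemma std_normal_vector_split:
  "std_normal_vector (a + b) = distr (std_normal_vector a \<Otimes>\<^sub>M std_normal_vector b)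
     (\<Pi>\<^sub>M i\<in>{..<a + b}. borel) (\<lambda>(x, y). \<lambda>i\<in>{..<a + b}. if i < a then x i else y (i - a))"
proof -
  let ?N = "density lborel (\<lambda>x. ennreal (std_normal_density x))"
  interpret product_sigma_finite "\<lambda>_::nat. ?N" by (rule product_sigma_finite_std_normal)
  interpret B: prob_space "std_normal_vector b" by (rule prob_space_std_normal_vector)
  let ?f = "\<lambda>(x, y). \<lambda>i\<in>{..<a + b}. if i < a then x i else y (i - a) :: real"
  note m = std_normal_vector_split_measurable[of a b]
  have "distr (std_normal_vector a \<Otimes>\<^sub>M std_normal_vector b) (\<Pi>\<^sub>M i\<in>{..<a + b}. borel) ?f
      = (\<Pi>\<^sub>M i\<in>{..<a + b}. ?N)"
  proof (rule PiM_eqI)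
    fix A assume "\<And>i. i \<in> {..<a + b} \<Longrightarrow> A i \<in> sets ?N"
    hence A: "A i \<in> sets borel" if "i < a + b" for i using that by simp
    have "emeasure (distr (std_normal_vector a \<Otimes>\<^sub>M std_normal_vector b) (\<Pi>\<^sub>M i\<in>{..<a + b}. borel) ?f)
        (Pi\<^sub>E {..<a + b} A)
      = emeasure (std_normal_vector a \<Otimes>\<^sub>M std_normal_vector b)
        (?f -` (Pi\<^sub>E {..<a + b} A) \<inter> space (std_normal_vector a \<Otimes>\<^sub>M std_normal_vector b))"
      using A by (intro emeasure_distr m sets_PiM_I_finite) auto
    also have "?f -` (Pi\<^sub>E {..<a + b} A) \<inter> space (std_normal_vector a \<Otimes>\<^sub>M std_normal_vector b)
      = Pi\<^sub>E {..<a} A \<times> Pi\<^sub>E {..<b} (\<lambda>i. A (a + i))"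
    proof -
      have "(\<lambda>i\<in>{..<a + b}. if i < a then x i else y (i - a)) \<in> Pi\<^sub>E {..<a + b} A
        \<longleftrightarrow> (\<forall>i<a. x i \<in> A i) \<and> (\<forall>i<b. y i \<in> A (a + i))" for x y
      proof -
        have "(\<forall>i<b. y i \<in> A (a + i)) \<longleftrightarrow> (\<forall>i. a \<le> i \<and> i < a + b \<longrightarrow> y (i - a) \<in> A i)"
          by (metis add_diff_cancel_left' le_add1 le_add_diff_inverse nat_add_left_cancel_less)
        thus ?thesis by (auto simp: PiE_iff not_less)
      qed
      thus ?thesis
        by (auto simp: std_normal_vector_def space_pair_measure space_PiM PiE_iff)
    qed
    also have "emeasure (std_normal_vector a \<Otimes>\<^sub>M std_normal_vector b) \<dots>
      = emeasure (std_normal_vector a) (Pi\<^sub>E {..<a} A)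
        * emeasure (std_normal_vector b) (Pi\<^sub>E {..<b} (\<lambda>i. A (a + i)))"
      using A by (intro B.emeasure_pair_measure_Times) (auto simp: std_normal_vector_def intro!: sets_PiM_I_finite)
    also have "\<dots> = (\<Prod>i<a. emeasure ?N (A i)) * (\<Prod>i<b. emeasure ?N (A (a + i)))"
      unfolding std_normal_vector_def
      using A by (intro arg_cong2[where f = "(*)"] emeasure_PiM) auto
    also have "(\<Prod>i<b. emeasure ?N (A (a + i))) = (\<Prod>i=a..<a + b. emeasure ?N (A i))"
      by (rule prod.reindex_bij_witness[of _ "\<lambda>i. i - a" "\<lambda>i. a + i"]) auto
    also have "(\<Prod>i<a. emeasure ?N (A i)) * \<dots> = (\<Prod>i<a + b. emeasure ?N (A i))"
      by (subst prod.union_disjoint[symmetric]) (auto intro!: prod.cong)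
    finally show "emeasure (distr (std_normal_vector a \<Otimes>\<^sub>M std_normal_vector b) (\<Pi>\<^sub>M i\<in>{..<a + b}. borel) ?f)
        (Pi\<^sub>E {..<a + b} A) = (\<Prod>i<a + b. emeasure ?N (A i))" .
  qed (auto intro!: sets_PiM_cong)
  thus ?thesis by (simp add: std_normal_vector_def)
qed

text \<open>\<open>S\<close> is the change of basis carrying \<open>Basis\<close> to the family
  \<open>e\<close>. It links coordinates numbered by naturals to those of the Euclidean type, for
  which Lebesgue integrals factor.\<close>

lemma orthonormal_coordinates_isometry:
  fixes e :: "nat \<Rightarrow> 'a::euclidean_space"
  assumes on: "\<And>i j. i < DIM('a) \<Longrightarrow> j < DIM('a) \<Longrightarrow> e i \<bullet> e j = (if i = j then 1 else 0)"
    and \<beta>: "bij_betw \<beta> (Basis :: 'a set) {..<DIM('a)}"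
  defines "S \<equiv> \<lambda>y. \<Sum>b\<in>Basis. (y \<bullet> b) *\<^sub>R e (\<beta> b)"
  shows "orthogonal_transformation S" and "\<And>b y. b \<in> Basis \<Longrightarrow> e (\<beta> b) \<bullet> S y = y \<bullet> b"
proof -
  have \<beta>_less: "\<beta> b < DIM('a)" if "b \<in> Basis" for b using \<beta> that by (auto dest: bij_betwE)
  have \<beta>_eq: "\<beta> b = \<beta> c \<longleftrightarrow> b = c" if "b \<in> Basis" "c \<in> Basis" for b c
    using bij_betw_imp_inj_on[OF \<beta>] that by (simp add: inj_on_eq_iff)
  show coord: "e (\<beta> b) \<bullet> S y = y \<bullet> b" if "b \<in> Basis" for b y
  proof -
    have "e (\<beta> b) \<bullet> S y = (\<Sum>c\<in>Basis. if b = c then y \<bullet> c else 0)"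
      unfolding S_def inner_sum_right
      by (intro sum.cong) (use that in \<open>auto simp: on \<beta>_less \<beta>_eq\<close>)
    thus ?thesis using that by simp
  qed
  have "linear S" unfolding S_def
    by (rule linearI) (simp_all add: inner_add_left scaleR_add_left sum.distrib scaleR_sum_right)
  moreover have "S v \<bullet> S w = v \<bullet> w" for v w
    by (subst (1) S_def) (simp add: inner_sum_left coord euclidean_inner[of v w])
  ultimately show "orthogonal_transformation S" by (simp add: orthogonal_transformation_def)
qed

lemma bij_betw_Basis_lessThan:
  obtains \<beta> where "bij_betw \<beta> (Basis :: 'a::euclidean_space set) {..<DIM('a)}"
  by (metis ex_bij_betw_finite_nat finite_Basis lessThan_atLeast0)

text \<open>With \<open>y = S z\<close>, the coordinates of \<open>y\<close> along \<open>e\<close>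
  are those of \<open>z\<close> along \<open>Basis\<close>, and \<open>S\<close> preserves the
  norm.\<close>

lemma orthonormal_parseval:
  fixes e :: "nat \<Rightarrow> 'a::euclidean_space"
  assumes "\<And>i j. i < DIM('a) \<Longrightarrow> j < DIM('a) \<Longrightarrow> e i \<bullet> e j = (if i = j then 1 else 0)"
  shows "(norm y)\<^sup>2 = (\<Sum>i<DIM('a). (e i \<bullet> y)\<^sup>2)"
proof -
  obtain \<beta> where \<beta>: "bij_betw \<beta> (Basis :: 'a set) {..<DIM('a)}" using bij_betw_Basis_lessThan .
  define S where "S y = (\<Sum>b\<in>Basis. (y \<bullet> b) *\<^sub>R e (\<beta> b))" for y :: 'a
  note S = orthonormal_coordinates_isometry[of e, OF assms \<beta>, folded S_def]
  obtain z where y: "y = S z" using orthogonal_transformation_surj[OF S(1)] by (metis surjD)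
  have "(\<Sum>i<DIM('a). (e i \<bullet> y)\<^sup>2) = (\<Sum>b\<in>Basis. (e (\<beta> b) \<bullet> y)\<^sup>2)"
    by (rule sum.reindex_bij_betw[OF \<beta>, symmetric])
  also have "\<dots> = (\<Sum>b\<in>Basis. (z \<bullet> b)\<^sup>2)" by (simp add: y S(2))
  also have "\<dots> = (norm z)\<^sup>2"
    unfolding power2_norm_eq_inner euclidean_inner[of z z] by (simp add: power2_eq_square)
  finally show ?thesis by (simp add: y orthogonal_transformation_norm[OF S(1)])
qed

section \<open>Coordinates of an isotropic normal vector\<close>

lemma isotropic_normal_density_prod:
  fixes y :: "real^'m"
  assumes "0 < \<sigma>"
  shows "isotropic_normal_density \<sigma> y = (\<Prod>b\<in>Basis. normal_density 0 \<sigma> (y \<bullet> b))"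
proof -
  let ?c = "1 / sqrt (2 * pi * \<sigma>\<^sup>2)"
  have "(\<Prod>b\<in>Basis. normal_density 0 \<sigma> (y \<bullet> b))
      = (\<Prod>b\<in>Basis. ?c * exp (- (y \<bullet> b)\<^sup>2 / (2 * \<sigma>\<^sup>2)))"
    by (simp only: normal_density_def diff_zero)
  also have "\<dots> = ?c ^ CARD('m) * exp (\<Sum>b\<in>Basis. - (y \<bullet> b)\<^sup>2 / (2 * \<sigma>\<^sup>2))"
    by (simp only: prod.distrib prod_constant exp_sum[OF finite_Basis] DIM_cart DIM_real mult_1_right)
  also have "(\<Sum>b\<in>Basis. - (y \<bullet> b)\<^sup>2 / (2 * \<sigma>\<^sup>2)) = - (norm y)\<^sup>2 / (2 * \<sigma>\<^sup>2)"
  proof -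
    have "(norm y)\<^sup>2 = (\<Sum>b\<in>Basis. (y \<bullet> b)\<^sup>2)"
      unfolding power2_norm_eq_inner euclidean_inner[of y y] by (simp only: power2_eq_square)
    thus ?thesis by (simp only: sum_divide_distrib[symmetric] sum_negf)
  qed
  finally show ?thesis
    by (simp only: isotropic_normal_density_def real_sqrt_power power_one_over
      times_divide_eq_left mult_1_left)
qed

text \<open>The substitution of \<open>\<sigma> * x\<close> for \<open>x\<close>: dividing a
  centered normal variable by its standard deviation makes it standard normal.\<close>

lemma nn_integral_normal_scale:
  assumes "0 < \<sigma>" and [measurable]: "A \<in> sets borel"
  shows "(\<integral>\<^sup>+x. ennreal (normal_density 0 \<sigma> x) * indicator A (x / \<sigma>) \<partial>lborel)
    = emeasure (density lborel (\<lambda>x. ennreal (std_normal_density x))) A"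
proof -
  have "(\<integral>\<^sup>+x. ennreal (normal_density 0 \<sigma> x) * indicator A (x / \<sigma>) \<partial>lborel)
    = ennreal \<bar>\<sigma>\<bar> * (\<integral>\<^sup>+x. ennreal (normal_density 0 \<sigma> (0 + \<sigma> * x)) * indicator A ((0 + \<sigma> * x) / \<sigma>) \<partial>lborel)"
    using assms by (intro nn_integral_real_affine) auto
  also have "\<dots> = (\<integral>\<^sup>+x. ennreal \<sigma> * (ennreal (normal_density 0 \<sigma> (\<sigma> * x)) * indicator A x) \<partial>lborel)"
    using assms by (simp add: nn_integral_cmult)
  also have "\<dots> = (\<integral>\<^sup>+x. ennreal (std_normal_density x) * indicator A x \<partial>lborel)"
  proof (rule nn_integral_cong)
    fix x
    have "\<sigma> * normal_density 0 \<sigma> (\<sigma> * x) = std_normal_density x"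
      using assms(1) by (simp add: normal_density_def real_sqrt_mult power_mult_distrib)
    thus "ennreal \<sigma> * (ennreal (normal_density 0 \<sigma> (\<sigma> * x)) * indicator A x)
        = ennreal (std_normal_density x) * indicator A x"
      using assms(1) by (simp add: mult.assoc[symmetric] flip: ennreal_mult)
  qed
  finally show ?thesis by (simp add: emeasure_density)
qed

text \<open>In the integral over a box, substituting the isometry \<open>S\<close> changes neither
  Lebesgue measure nor the density, which depends on the norm only. Coordinates along
  \<open>e\<close> become standard ones, and the integral splits into one-dimensional
  factors.\<close>

lemma distr_isotropic_normal:
  fixes e :: "nat \<Rightarrow> real^'m"
  assumes \<sigma>: "0 < \<sigma>"
    and on: "\<And>i j. i < CARD('m) \<Longrightarrow> j < CARD('m) \<Longrightarrow> e i \<bullet> e j = (if i = j then 1 else 0)"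
  shows "distr (density lborel (\<lambda>y. ennreal (isotropic_normal_density \<sigma> y)))
      (\<Pi>\<^sub>M i\<in>{..<CARD('m)}. borel) (\<lambda>y. \<lambda>i\<in>{..<CARD('m)}. (e i \<bullet> y) / \<sigma>)
    = std_normal_vector CARD('m)"
proof -
  let ?N = "density lborel (\<lambda>x. ennreal (std_normal_density x))" and ?m = "CARD('m)"
  let ?D = "density lborel (\<lambda>y::real^'m. ennreal (isotropic_normal_density \<sigma> y))"
  let ?Z = "\<lambda>y. \<lambda>i\<in>{..<?m}. (e i \<bullet> y) / \<sigma>"
  interpret product_sigma_finite "\<lambda>_::nat. ?N" by (rule product_sigma_finite_std_normal)
  obtain \<beta> where \<beta>: "bij_betw \<beta> (Basis :: (real^'m) set) {..<?m}"
    using bij_betw_Basis_lessThan[where 'a = "real^'m"] by auto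
  define S where "S y = (\<Sum>b\<in>Basis. (y \<bullet> b) *\<^sub>R e (\<beta> b))" for y :: "real^'m"
  have S: "orthogonal_transformation S" "\<And>b y. b \<in> Basis \<Longrightarrow> e (\<beta> b) \<bullet> S y = y \<bullet> b"
    using orthonormal_coordinates_isometry[of e \<beta>] on \<beta> by (auto simp: S_def[abs_def])
  have S_meas [measurable]: "S \<in> borel_measurable borel" unfolding S_def[abs_def] by measurable
  have iso_meas [measurable]: "(\<lambda>y::real^'m. isotropic_normal_density \<sigma> y) \<in> borel_measurable borel"
    unfolding isotropic_normal_density_def by measurable
  have Z: "?Z \<in> ?D \<rightarrow>\<^sub>M (\<Pi>\<^sub>M i\<in>{..<?m}. borel)" by (intro measurable_restrict) simp
  have "distr ?D (\<Pi>\<^sub>M i\<in>{..<?m}. borel) ?Z = (\<Pi>\<^sub>M i\<in>{..<?m}. ?N)"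
  proof (rule PiM_eqI)
    fix A assume "\<And>i. i \<in> {..<?m} \<Longrightarrow> A i \<in> sets ?N"
    hence A [measurable]: "A i \<in> sets borel" if "i < ?m" for i using that by simp
    have A\<beta> [measurable]: "A (\<beta> b) \<in> sets borel" if "b \<in> Basis" for b
      using A bij_betwE[OF \<beta>] that by auto
    let ?G = "\<lambda>y. ennreal (isotropic_normal_density \<sigma> y) * (\<Prod>b\<in>Basis. indicator (A (\<beta> b)) ((e (\<beta> b) \<bullet> y) / \<sigma>))"
    have E: "?Z -` (Pi\<^sub>E {..<?m} A) \<inter> space ?D = {y. \<forall>b\<in>Basis. (e (\<beta> b) \<bullet> y) / \<sigma> \<in> A (\<beta> b)}"
    proof (rule set_eqI)
      fix y
      have "(\<forall>i<?m. R i) \<longleftrightarrow> (\<forall>b\<in>Basis. R (\<beta> b))" for R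
        unfolding bij_betw_imp_surj_on[OF \<beta>, symmetric] lessThan_iff[symmetric]
        by blast
      note this[of "\<lambda>i. (e i \<bullet> y) / \<sigma> \<in> A i"]
      moreover have "?Z y \<in> Pi\<^sub>E {..<?m} A \<longleftrightarrow> (\<forall>i<?m. (e i \<bullet> y) / \<sigma> \<in> A i)"
        by (simp only: restrict_PiE_iff lessThan_iff Ball_def)
      ultimately show "y \<in> ?Z -` (Pi\<^sub>E {..<?m} A) \<inter> space ?D
          \<longleftrightarrow> y \<in> {y. \<forall>b\<in>Basis. (e (\<beta> b) \<bullet> y) / \<sigma> \<in> A (\<beta> b)}"
        by (simp only: vimage_eq Int_iff mem_Collect_eq space_density space_lborel space_borel UNIV_I simp_thms)
    qed
    have "Pi\<^sub>E {..<?m} A \<in> sets (\<Pi>\<^sub>M i\<in>{..<?m}. borel)"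
      using A by (intro sets_PiM_I_finite) auto
    note E_sets = measurable_sets[OF Z this]
    have "emeasure (distr ?D (\<Pi>\<^sub>M i\<in>{..<?m}. borel) ?Z) (Pi\<^sub>E {..<?m} A)
        = emeasure ?D (?Z -` (Pi\<^sub>E {..<?m} A) \<inter> space ?D)"
      using A by (intro emeasure_distr Z sets_PiM_I_finite) auto
    also have "\<dots> = (\<integral>\<^sup>+y. ennreal (isotropic_normal_density \<sigma> y)
        * indicator {y. \<forall>b\<in>Basis. (e (\<beta> b) \<bullet> y) / \<sigma> \<in> A (\<beta> b)} y \<partial>lborel)"
      unfolding E[symmetric] using E_sets by (intro emeasure_density) auto
    also have "\<dots> = (\<integral>\<^sup>+y. ?G y \<partial>lborel)"
      by (intro nn_integral_cong) (auto simp: indicator_def prod_zero_iff)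
    also have "\<dots> = (\<integral>\<^sup>+y. ?G (S y) \<partial>lborel)"
    proof -
      have "(\<lambda>y. indicator (A (\<beta> b)) ((e (\<beta> b) \<bullet> y) / \<sigma>) :: ennreal) \<in> borel_measurable borel"
        if "b \<in> Basis" for b
      proof -
        have "(\<lambda>y. (e (\<beta> b) \<bullet> y) / \<sigma>) \<in> borel_measurable borel" by simp
        thus ?thesis by (rule measurable_compose) (rule borel_measurable_indicator[OF A\<beta>[OF that]])
      qed
      hence "(\<lambda>y. \<Prod>b\<in>Basis. indicator (A (\<beta> b)) ((e (\<beta> b) \<bullet> y) / \<sigma>) :: ennreal) \<in> borel_measurable borel"
        by (rule borel_measurable_prod_ennreal)
      moreover have "(\<lambda>y::real^'m. ennreal (isotropic_normal_density \<sigma> y)) \<in> borel_measurable borel"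
        using iso_meas by (rule measurable_compose) (rule measurable_ennreal)
      ultimately have "?G \<in> borel_measurable borel" by (rule borel_measurable_times_ennreal[rotated])
      hence "(\<integral>\<^sup>+y. ?G y \<partial>distr lborel borel S) = (\<integral>\<^sup>+y. ?G (S y) \<partial>lborel)"
        using S_meas by (intro nn_integral_distr) (simp_all only: measurable_lborel1 measurable_lborel2 measurable_distr_eq1)
      thus ?thesis by (simp only: distr_lborel_orthogonal_transformation[OF S(1)])
    qed
    also have "\<dots> = (\<integral>\<^sup>+y. (\<Prod>b\<in>Basis. ennreal (normal_density 0 \<sigma> (y \<bullet> b)) * indicator (A (\<beta> b)) ((y \<bullet> b) / \<sigma>)) \<partial>lborel)"
    proof (rule nn_integral_cong)
      fix y :: "real^'m"
      have "isotropic_normal_density \<sigma> (S y) = isotropic_normal_density \<sigma> y"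
        by (simp add: isotropic_normal_density_def orthogonal_transformation_norm[OF S(1)])
      thus "?G (S y) = (\<Prod>b\<in>Basis. ennreal (normal_density 0 \<sigma> (y \<bullet> b)) * indicator (A (\<beta> b)) ((y \<bullet> b) / \<sigma>))"
        by (simp add: S(2) prod.distrib isotropic_normal_density_prod[OF \<sigma>] prod_ennreal)
    qed
    also have "\<dots> = (\<Prod>b\<in>(Basis :: (real^'m) set). emeasure ?N (A (\<beta> b)))"
      using A\<beta> \<sigma> by (subst nn_integral_lborel_prod) (auto intro!: prod.cong nn_integral_normal_scale)
    also have "\<dots> = (\<Prod>i<?m. emeasure ?N (A i))"
      by (rule prod.reindex_bij_betw[OF \<beta>])
    finally show "emeasure (distr ?D (\<Pi>\<^sub>M i\<in>{..<?m}. borel) ?Z) (Pi\<^sub>E {..<?m} A)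
        = (\<Prod>i<?m. emeasure ?N (A i))" .
  qed (auto intro!: sets_PiM_cong)
  thus ?thesis by (simp add: std_normal_vector_def)
qed

text \<open>\<open>u\<close> and the columns of \<open>Q\<close> are orthonormal and extend to an
  orthogonal basis. The order is chosen for the later split: index 0 carries the shift by
  \<open>X\<close>, indices below \<open>CARD('m) - CARD('n)\<close> span the complement of the
  range of \<open>Q\<close>, and the columns come last, numbered by \<open>g\<close>.\<close>

lemma orthonormal_basis_adapted:
  fixes Q :: "real^'n^'m" and u :: "real^'m"
  assumes less: "CARD('n) < CARD('m)" and Q: "transpose Q ** Q = mat 1"
    and u: "norm u = 1" "transpose Q *v u = 0"
  obtains e :: "nat \<Rightarrow> real^'m" and g :: "nat \<Rightarrow> 'n"
  where "\<And>i j. i < CARD('m) \<Longrightarrow> j < CARD('m) \<Longrightarrow> e i \<bullet> e j = (if i = j then 1 else 0)"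
    "e 0 = u" "bij_betw g {..<CARD('n)} UNIV"
    "\<And>i. i < CARD('n) \<Longrightarrow> e (CARD('m) - CARD('n) + i) = column (g i) Q"
proof -
  let ?m = "CARD('m)" and ?n = "CARD('n)"
  let ?d = "?m - ?n" and ?C = "range (\<lambda>j. column j Q)"
  have cols: "column i Q \<bullet> column j Q = (if i = j then 1 else 0)" for i j
    using arg_cong[OF Q, of "\<lambda>A. A $ i $ j"]
    by (simp add: matrix_matrix_mult_def transpose_def column_def mat_def inner_vec_def)
  have u_cols: "column j Q \<bullet> u = 0" for j
    using arg_cong[OF u(2), of "\<lambda>x. x $ j"]
    by (simp add: vector_matrix_mult_def column_def inner_vec_def mult.commute)
  have inj_cols: "inj (\<lambda>j. column j Q)"
    by (rule injI) (metis cols zero_neq_one)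
  have cols_u: "u \<bullet> column j Q = 0" for j using u_cols by (simp only: inner_commute)
  have uu: "u \<bullet> u = 1" using u(1) by (simp add: norm_eq_1)
  have "pairwise orthogonal (insert u ?C)"
    by (auto simp: pairwise_def orthogonal_def cols u_cols cols_u)
  then obtain U where U: "U \<inter> insert 0 (insert u ?C) = {}" "pairwise orthogonal (insert u ?C \<union> U)"
      "span (insert u ?C \<union> U) = span (insert u ?C \<union> UNIV)"
    by (rule orthogonal_extension_strong[where T = UNIV])
  define E where "E = insert u ?C \<union> U"
  have E: "pairwise orthogonal E" "span E = UNIV"
    using U(2,3) by (simp_all only: E_def Un_UNIV_right span_UNIV)
  have "column j Q \<noteq> 0" for j using cols[of j j] by auto
  hence "0 \<notin> ?C" by auto
  moreover have "u \<noteq> 0" using uu by auto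
  ultimately have E0: "0 \<notin> E" using U(1) by (auto simp: E_def)
  have "independent E" using E(1) E0 by (rule pairwise_orthogonal_independent)
  hence finE: "finite E" and "card E = dim E"
    by (auto simp: independent_imp_finite dim_eq_card_independent)
  hence cardE: "card E = ?m" using E(2) by (metis DIM_cart DIM_real dim_UNIV dim_span mult.right_neutral)
  have "u \<notin> ?C" using uu u_cols by fastforce
  moreover have "card ?C = ?n" using inj_cols by (simp add: card_image)
  ultimately have "card (insert u ?C) = Suc ?n" by simp
  \<comment> \<open>\<open>u\<close> takes one of the first \<open>?d\<close> places, which leaves
    the indices \<open>{1..<?d}\<close> for the added vectors.\<close>
  hence "card (E - insert u ?C) = ?d - 1"
    using cardE finE by (subst card_Diff_subset) (auto simp: E_def)
  then obtain h where h: "bij_betw h {1..<?d} (E - insert u ?C)"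
    using finite_same_card_bij[of "{1..<?d}" "E - insert u ?C"] finE by auto
  obtain g where g: "bij_betw g {..<?n} (UNIV :: 'n set)"
    using finite_same_card_bij[of "{..<?n}" "UNIV :: 'n set"] by auto
  define f where "f i = (if i = 0 then u else if i < ?d then h i else column (g (i - ?d)) Q)" for i
  have hE: "h i \<in> E - insert u ?C" if "0 < i" "i < ?d" for i
    using bij_betwE[OF h] that by auto
  have fE: "f i \<in> E" if "i < ?m" for i
    using hE[of i] by (auto simp: f_def E_def)
  have h_inj: "i = j" if "h i = h j" "0 < i" "i < ?d" "0 < j" "j < ?d" for i j
    using inj_onD[OF bij_betw_imp_inj_on[OF h] that(1)] that by auto
  have g_inj: "i = j" if "g (i - ?d) = g (j - ?d)" "?d \<le> i" "i < ?m" "?d \<le> j" "j < ?m" for i j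
  proof -
    have "i - ?d < ?n" "j - ?d < ?n" using that less by linarith+
    hence "i - ?d = j - ?d" using inj_onD[OF bij_betw_imp_inj_on[OF g] that(1)] by simp
    thus ?thesis using that by linarith
  qed
  \<comment> \<open>The three blocks of indices have disjoint values under \<open>f\<close>, so
    injectivity can be checked block by block.\<close>
  have f_u: "f i = u \<longleftrightarrow> i = 0" for i
  proof (cases "i < ?d")
    case True
    thus ?thesis using hE[of i] by (auto simp: f_def)
  next
    case False
    thus ?thesis using \<open>u \<notin> ?C\<close> less by (auto simp: f_def)
  qed
  have f_C: "f i \<in> ?C \<longleftrightarrow> ?d \<le> i" for i
    using hE[of i] \<open>u \<notin> ?C\<close> less by (auto simp: f_def not_less[symmetric] simp del: image_iff)
  have f_inj: "i = j" if eq: "f i = f j" and ij: "i < ?m" "j < ?m" for i j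
  proof -
    have iff: "i = 0 \<longleftrightarrow> j = 0" "?d \<le> i \<longleftrightarrow> ?d \<le> j" using eq f_u f_C by metis+
    consider "i = 0" | "?d \<le> i" | "0 < i" "i < ?d" by linarith
    thus ?thesis
    proof cases
      case 1
      thus ?thesis using iff by simp
    next
      case 2
      hence "f i = column (g (i - ?d)) Q" "f j = column (g (j - ?d)) Q"
        using iff less by (auto simp: f_def)
      thus ?thesis using eq g_inj ij 2 iff injD[OF inj_cols] by metis
    next
      case 3
      hence "0 < j" "j < ?d" using iff by linarith+
      thus ?thesis using eq h_inj 3 by (auto simp: f_def)
    qed
  qed
  \<comment> \<open>The added vectors are only orthogonal. Normalizing fixes \<open>u\<close> and
    the columns of \<open>Q\<close>, which already have norm 1.\<close>
  define e where "e i = (1 / norm (f i)) *\<^sub>R f i" for i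
  show thesis
  proof (rule that)
    fix i j assume ij: "i < ?m" "j < ?m"
    show "e i \<bullet> e j = (if i = j then 1 else 0)"
    proof (cases "i = j")
      case True
      have "f i \<noteq> 0" using fE[OF ij(1)] E0 by auto
      thus ?thesis using True by (simp add: e_def flip: power2_norm_eq_inner power2_eq_square)
    next
      case False
      hence "orthogonal (f i) (f j)" using E(1) fE ij f_inj by (metis pairwise_def)
      thus ?thesis using False by (simp add: e_def orthogonal_def)
    qed
  next
    fix i assume "i < ?n"
    have "f k = column (g (k - ?d)) Q" if "?d \<le> k" for k
      using that less by (auto simp: f_def)
    from this[of "?d + i"] have "f (?d + i) = column (g i) Q"
      by (simp only: diff_add_inverse le_add1)
    moreover have "norm (column (g i) Q) = 1" by (simp add: norm_eq_1 cols)
    ultimately show "e (?d + i) = column (g i) Q" by (simp only: e_def div_by_1 scaleR_one)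
  qed (use u g in \<open>simp_all add: e_def f_def\<close>)
qed

section \<open>Chi-square and noncentral F distributions\<close>

lemma sets_std_normal_vector [measurable_cong, simp]:
  "sets (std_normal_vector d) = sets (\<Pi>\<^sub>M i\<in>{..<d}. borel)"
  by (auto simp: std_normal_vector_def intro!: sets_PiM_cong)

lemma prob_space_chi_square: "prob_space (chi_square d)"
  unfolding chi_square_def
  by (intro prob_space.prob_space_distr prob_space_std_normal_vector) measurable

lemma prob_space_noncentral_chi_square: "prob_space (noncentral_chi_square d nc)"
  unfolding noncentral_chi_square_def
  by (intro prob_space.prob_space_distr prob_space_std_normal_vector) measurable

lemma sets_chi_square [simp, measurable_cong]: "sets (chi_square d) = sets borel"
  by (simp add: chi_square_def)

lemma sets_noncentral_chi_square [simp, measurable_cong]: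
  "sets (noncentral_chi_square d nc) = sets borel"
  by (simp add: noncentral_chi_square_def)

text \<open>The two sums depend on separate blocks of coordinates, so after the split the map acts
  componentwise and the image of the product measure is the product of the images.\<close>

lemma distr_std_normal_vector_chi_squares:
  "distr (std_normal_vector (a + b)) (borel \<Otimes>\<^sub>M borel)
      (\<lambda>z. (\<Sum>i<a. ((if i = 0 then sqrt nc else 0) + z i)\<^sup>2, \<Sum>i<b. (z (a + i))\<^sup>2))
    = noncentral_chi_square a nc \<Otimes>\<^sub>M chi_square b"
proof -
  let ?U = "\<lambda>z. \<Sum>i<a. ((if i = 0 then sqrt nc else 0) + z i)\<^sup>2"
  let ?J = "\<lambda>(x, y). \<lambda>i\<in>{..<a + b}. if i < a then x i else y (i - a)"
  have U: "?U \<in> borel_measurable (\<Pi>\<^sub>M i\<in>I. borel)" if "{..<a} \<subseteq> I" for I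
    using that by (intro borel_measurable_sum borel_measurable_power borel_measurable_add
      measurable_const measurable_component_singleton) auto
  have V: "(\<lambda>z. \<Sum>i<b. (z (k + i) :: real)\<^sup>2) \<in> borel_measurable (\<Pi>\<^sub>M i\<in>{..<k + b}. borel)" for k
    by (intro borel_measurable_sum borel_measurable_power measurable_component_singleton) auto
  have J: "?J \<in> std_normal_vector a \<Otimes>\<^sub>M std_normal_vector b \<rightarrow>\<^sub>M (\<Pi>\<^sub>M i\<in>{..<a + b}. borel)"
    by (rule std_normal_vector_split_measurable)
  have "distr (std_normal_vector (a + b)) (borel \<Otimes>\<^sub>M borel) (\<lambda>z. (?U z, \<Sum>i<b. (z (a + i))\<^sup>2))
    = distr (std_normal_vector a \<Otimes>\<^sub>M std_normal_vector b) (borel \<Otimes>\<^sub>M borel)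
        ((\<lambda>z. (?U z, \<Sum>i<b. (z (a + i))\<^sup>2)) \<circ> ?J)"
    unfolding std_normal_vector_split[of a b]
    by (rule distr_distr[OF _ J]) (intro measurable_Pair U V, auto)
  also have "(\<lambda>z. (?U z, \<Sum>i<b. (z (a + i))\<^sup>2)) \<circ> ?J = (\<lambda>(x, y). (?U x, \<Sum>i<b. (y i)\<^sup>2))"
    by (auto simp: fun_eq_iff intro!: sum.cong)
  also have "distr (std_normal_vector a \<Otimes>\<^sub>M std_normal_vector b) (borel \<Otimes>\<^sub>M borel) \<dots>
      = noncentral_chi_square a nc \<Otimes>\<^sub>M chi_square b"
    unfolding noncentral_chi_square_def chi_square_def
  proof (rule pair_measure_distr[symmetric])
    show "?U \<in> borel_measurable (std_normal_vector a)" using U[of "{..<a}"] by simp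
    show "(\<lambda>z. \<Sum>i<b. (z i)\<^sup>2) \<in> borel_measurable (std_normal_vector b)" using V[of 0] by simp
    show "sigma_finite_measure (distr (std_normal_vector b) borel (\<lambda>z. \<Sum>i<b. (z i)\<^sup>2))"
      using prob_space_chi_square[of b] unfolding chi_square_def by (rule prob_space_imp_sigma_finite)
  qed
  finally show ?thesis .
qed

text \<open>With all coordinates but the last fixed, at most two values of the last one solve the
  equation, a null set for the normal law; Fubini concludes. For \<open>d = 0\<close> the law is the
  point mass at 0.\<close>

lemma chi_square_atomless:
  assumes "0 < d"
  shows "emeasure (chi_square d) {t} = 0"
proof -
  let ?N = "density lborel (\<lambda>x. ennreal (std_normal_density x))"
  interpret product_sigma_finite "\<lambda>_::nat. ?N" by (rule product_sigma_finite_std_normal)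
  obtain k where d: "d = Suc k" using assms by (cases d) auto
  have m: "(\<lambda>z. \<Sum>i<d. (z i)\<^sup>2) \<in> borel_measurable (\<Pi>\<^sub>M i\<in>insert k {..<k}. ?N)"
    unfolding d lessThan_Suc by measurable
  have count: "emeasure ?N {y. s + y\<^sup>2 = t} = 0" for s :: real
  proof -
    have "{y. s + y\<^sup>2 = t} \<subseteq> {sqrt (t - s), - sqrt (t - s)}"
      by (auto simp: real_sqrt_abs abs_if)
    hence fin: "finite {y. s + y\<^sup>2 = t}" by (rule finite_subset) simp
    hence "emeasure lborel {y. s + y\<^sup>2 = t} = 0"
      by (intro emeasure_lborel_countable countable_finite)
    moreover have "{y. s + y\<^sup>2 = t} \<in> sets lborel" by simp
    ultimately have "{y. s + y\<^sup>2 = t} \<in> null_sets lborel" by (rule null_setsI)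
    moreover have "absolutely_continuous lborel ?N"
      by (intro absolutely_continuousI_density) simp
    ultimately have "{y. s + y\<^sup>2 = t} \<in> null_sets ?N" unfolding absolutely_continuous_def by blast
    thus ?thesis by (rule null_setsD1)
  qed
  have "emeasure (chi_square d) {t}
      = emeasure (std_normal_vector d) ((\<lambda>z. \<Sum>i<d. (z i)\<^sup>2) -` {t} \<inter> space (std_normal_vector d))"
    (is "_ = emeasure _ (?f -` _ \<inter> _)")
    unfolding chi_square_def using m by (intro emeasure_distr) (auto simp: std_normal_vector_def d lessThan_Suc)
  also have "\<dots> = (\<integral>\<^sup>+z. indicator {t} (\<Sum>i<d. (z i)\<^sup>2) \<partial>std_normal_vector d)"
    (is "emeasure ?S _ = _")
  proof -
    have "?f -` {t} \<inter> space ?S \<in> sets ?S"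
      by (rule measurable_sets[of _ _ borel]) (use m in \<open>auto simp: std_normal_vector_def d lessThan_Suc\<close>)
    hence "emeasure ?S (?f -` {t} \<inter> space ?S) = (\<integral>\<^sup>+z. indicator (?f -` {t} \<inter> space ?S) z \<partial>?S)"
      by simp
    also have "\<dots> = (\<integral>\<^sup>+z. indicator {t} (?f z) \<partial>?S)"
      by (intro nn_integral_cong) (simp add: indicator_def)
    finally show ?thesis .
  qed
  also have "\<dots> = (\<integral>\<^sup>+z. (\<integral>\<^sup>+y. indicator {t} (\<Sum>i<d. ((z(k := y)) i)\<^sup>2) \<partial>?N) \<partial>(\<Pi>\<^sub>M i\<in>{..<k}. ?N))"
    unfolding std_normal_vector_def d lessThan_Suc
    by (intro product_nn_integral_insert) (use m in \<open>auto simp: d lessThan_Suc\<close>)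
  also have "\<dots> = (\<integral>\<^sup>+z. emeasure ?N {y. (\<Sum>i<k. (z i)\<^sup>2) + y\<^sup>2 = t} \<partial>(\<Pi>\<^sub>M i\<in>{..<k}. ?N))"
  proof (intro nn_integral_cong)
    fix z
    have "(\<Sum>i<d. ((z(k := y)) i)\<^sup>2) = (\<Sum>i<k. (z i)\<^sup>2) + y\<^sup>2" for y :: real by (simp add: d)
    hence "(\<integral>\<^sup>+y. indicator {t} (\<Sum>i<d. ((z(k := y)) i)\<^sup>2) \<partial>?N)
      = (\<integral>\<^sup>+y. indicator {y. (\<Sum>i<k. (z i)\<^sup>2) + y\<^sup>2 = t} y \<partial>?N)"
      by (intro nn_integral_cong) (simp add: indicator_def)
    also have "\<dots> = emeasure ?N {y. (\<Sum>i<k. (z i)\<^sup>2) + y\<^sup>2 = t}"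
      by (intro nn_integral_indicator) simp
    finally show "(\<integral>\<^sup>+y. indicator {t} (\<Sum>i<d. ((z(k := y)) i)\<^sup>2) \<partial>?N)
      = emeasure ?N {y. (\<Sum>i<k. (z i)\<^sup>2) + y\<^sup>2 = t}" .
  qed
  finally show ?thesis by (simp add: count)
qed

lemma chi_square_AE_pos:
  assumes "0 < d"
  shows "AE v in chi_square d. 0 < v"
proof -
  have "AE v in chi_square d. 0 \<le> v"
    unfolding chi_square_def by (subst AE_distr_iff) (auto intro!: sum_nonneg)
  moreover have "AE v in chi_square d. v \<noteq> 0"
    using chi_square_atomless[OF assms] by (intro AE_I[where N = "{0}"]) auto
  ultimately show ?thesis by eventually_elim simp
qed

text \<open>For \<open>v > 0\<close> the quotient exceeds the threshold exactly when
  \<open>u > c * v\<close>, that is, when \<open>\<tau>\<^sup>2 * (u + v) < u\<close>. The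
  complement of the \<open>cdf\<close> event is strict while the event here is not; the two differ
  by a null set.\<close>

lemma one_minus_cdf_noncentral_F:
  assumes d: "0 < d1" "0 < d2" and \<tau>: "0 < \<tau>" "\<tau> < 1"
  shows "measure (noncentral_chi_square d1 nc \<Otimes>\<^sub>M chi_square d2) {(u, v). 0 < u + v \<and> \<tau>\<^sup>2 * (u + v) \<le> u}
    = 1 - cdf (noncentral_F d1 d2 nc) (real d2 * \<tau>\<^sup>2 / (real d1 * (1 - \<tau>\<^sup>2)))"
proof -
  let ?U = "noncentral_chi_square d1 nc" and ?V = "chi_square d2"
  let ?x = "real d2 * \<tau>\<^sup>2 / (real d1 * (1 - \<tau>\<^sup>2))"
  let ?F = "\<lambda>(u, v). (u / real d1) / (v / real d2)"
  define c where "c = \<tau>\<^sup>2 / (1 - \<tau>\<^sup>2)"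
  have \<tau>2: "0 < \<tau>\<^sup>2" "\<tau>\<^sup>2 < 1" using \<tau> by (simp_all add: abs_square_less_1)
  have c: "0 < c" using \<tau>2 by (simp add: c_def)
  interpret U: prob_space ?U by (rule prob_space_noncentral_chi_square)
  interpret V: prob_space ?V by (rule prob_space_chi_square)
  interpret UV: pair_prob_space ?U ?V ..
  have sets_UV: "sets (?U \<Otimes>\<^sub>M ?V) = sets (borel \<Otimes>\<^sub>M borel)" by (intro sets_pair_measure_cong) simp_all
  hence space_UV: "space (?U \<Otimes>\<^sub>M ?V) = UNIV" by (simp add: space_pair_measure cong: sets_eq_imp_space_eq)
  have F: "?F \<in> borel_measurable (?U \<Otimes>\<^sub>M ?V)" by measurable
  \<comment> \<open>For fixed \<open>u\<close> the boundary line excludes the single value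
    \<open>u / c\<close> of \<open>v\<close>, which has chi-square probability 0.\<close>
  have generic: "AE p in ?U \<Otimes>\<^sub>M ?V. 0 < snd p \<and> fst p \<noteq> c * snd p"
  proof (rule UV.AE_pair_measure)
    show "{p \<in> space (?U \<Otimes>\<^sub>M ?V). 0 < snd p \<and> fst p \<noteq> c * snd p} \<in> sets (?U \<Otimes>\<^sub>M ?V)"
      by measurable
    have "AE v in ?V. 0 < v \<and> u \<noteq> c * v" for u
    proof -
      have "AE v in ?V. v \<noteq> u / c"
        using chi_square_atomless[OF d(2)] by (intro AE_I[where N = "{u / c}"]) auto
      with chi_square_AE_pos[OF d(2)] show ?thesis
        by eventually_elim (use c in \<open>auto simp: field_simps\<close>)
    qed
    thus "AE u in ?U. AE v in ?V. 0 < snd (u, v) \<and> fst (u, v) \<noteq> c * snd (u, v)" by simp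
  qed
  have iff: "0 < u + v \<and> \<tau>\<^sup>2 * (u + v) \<le> u \<longleftrightarrow> \<not> ?F (u, v) \<le> ?x"
    if "0 < v" "u \<noteq> c * v" for u v
  proof -
    have "?F (u, v) \<le> ?x \<longleftrightarrow> u * (1 - \<tau>\<^sup>2) \<le> \<tau>\<^sup>2 * v"
    proof -
      have "?F (u, v) = real d2 / real d1 * (u / v)" "?x = real d2 / real d1 * (\<tau>\<^sup>2 / (1 - \<tau>\<^sup>2))"
        by simp_all
      moreover have "real d2 / real d1 > 0" using d by simp
      ultimately have "?F (u, v) \<le> ?x \<longleftrightarrow> u / v \<le> \<tau>\<^sup>2 / (1 - \<tau>\<^sup>2)"
        by (simp only: mult_le_cancel_left_pos)
      thus ?thesis using that \<tau>2 by (simp add: divide_le_eq le_divide_eq pos_divide_le_eq field_simps)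
    qed
    moreover have "u * (1 - \<tau>\<^sup>2) \<noteq> \<tau>\<^sup>2 * v" using that(2) \<tau>2 by (simp add: c_def field_simps)
    moreover have "0 < u" if "\<tau>\<^sup>2 * v \<le> u * (1 - \<tau>\<^sup>2)"
      using that \<open>0 < v\<close> \<tau>2 by (smt (verit) mult_pos_pos mult_nonpos_nonneg)
    ultimately show ?thesis using that(1) by (auto simp: algebra_simps)
  qed
  have "cdf (noncentral_F d1 d2 nc) ?x = measure (?U \<Otimes>\<^sub>M ?V) {p. ?F p \<le> ?x}"
    unfolding cdf_def noncentral_F_def using F
    by (subst measure_distr) (auto simp: space_UV vimage_def)
  hence "1 - cdf (noncentral_F d1 d2 nc) ?x = 1 - measure (?U \<Otimes>\<^sub>M ?V) {p. ?F p \<le> ?x}" by simp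
  also have "\<dots> = measure (?U \<Otimes>\<^sub>M ?V) {p. \<not> ?F p \<le> ?x}"
  proof -
    have "{p \<in> space (?U \<Otimes>\<^sub>M ?V). ?F p \<le> ?x} \<in> sets (?U \<Otimes>\<^sub>M ?V)"
      by (rule borel_measurable_le[OF F borel_measurable_const])
    from UV.prob_compl[OF this] show ?thesis by (simp only: space_UV set_diff_eq UNIV_I mem_Collect_eq simp_thms)
  qed
  also have "\<dots> = measure (?U \<Otimes>\<^sub>M ?V) {(u, v). 0 < u + v \<and> \<tau>\<^sup>2 * (u + v) \<le> u}"
  proof (rule UV.finite_measure_eq_AE)
    show "AE p in ?U \<Otimes>\<^sub>M ?V. p \<in> {p. \<not> ?F p \<le> ?x} \<longleftrightarrow> p \<in> {(u, v). 0 < u + v \<and> \<tau>\<^sup>2 * (u + v) \<le> u}"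
      using generic by eventually_elim (use iff in \<open>auto simp: case_prod_beta\<close>)
    have "{p \<in> space (?U \<Otimes>\<^sub>M ?V). \<not> ?F p \<le> ?x} \<in> sets (?U \<Otimes>\<^sub>M ?V)" by measurable
    thus "{p. \<not> ?F p \<le> ?x} \<in> sets (?U \<Otimes>\<^sub>M ?V)" by (simp only: space_UV UNIV_I simp_thms)
    have "{p \<in> space (?U \<Otimes>\<^sub>M ?V). case p of (u, v) \<Rightarrow> 0 < u + v \<and> \<tau>\<^sup>2 * (u + v) \<le> u}
        \<in> sets (?U \<Otimes>\<^sub>M ?V)" by measurable
    thus "{(u, v). 0 < u + v \<and> \<tau>\<^sup>2 * (u + v) \<le> u} \<in> sets (?U \<Otimes>\<^sub>M ?V)"
      by (simp only: space_UV UNIV_I simp_thms)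
  qed
  finally show ?thesis by simp
qed

section \<open>Projection of the normalized vector\<close>

text \<open>\<open>w\<close> is the sum of \<open>P *v w\<close> and
  \<open>Q *v (transpose Q *v w)\<close>. These are orthogonal, and \<open>Q\<close> preserves
  norms, so \<open>transpose Q *v w\<close> measures the component in the range of
  \<open>Q\<close>.\<close>

lemma norm_orthogonal_projection:
  fixes Q :: "real^'n^'m"
  assumes Q: "transpose Q ** Q = mat 1" and P: "P = mat 1 - Q ** transpose Q"
  shows "(norm (P *v w))\<^sup>2 + (norm (transpose Q *v w))\<^sup>2 = (norm w)\<^sup>2"
    and "transpose Q *v (P *v w) = 0"
proof -
  define z where "z = transpose Q *v w"
  have Pw: "P *v w = w - Q *v z"
    unfolding P z_def by (simp only: matrix_vector_mult_diff_rdistrib matrix_vector_mul_lid matrix_vector_mul_assoc)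
  have Qz: "transpose Q *v (Q *v z) = z"
    by (simp only: matrix_vector_mul_assoc Q matrix_vector_mul_lid)
  show perp: "transpose Q *v (P *v w) = 0"
    by (simp only: Pw matrix_vector_mult_diff_distrib Qz z_def[symmetric] diff_self)
  have "(Q *v z) \<bullet> (P *v w) = (transpose Q *v (P *v w)) \<bullet> z"
    unfolding inner_transpose_matrix_vector by (rule inner_commute)
  hence "orthogonal (P *v w) (Q *v z)"
    unfolding perp by (simp only: orthogonal_def inner_commute inner_zero_left)
  hence "(norm (P *v w + Q *v z))\<^sup>2 = (norm (P *v w))\<^sup>2 + (norm (Q *v z))\<^sup>2"
    by (rule norm_add_Pythagorean)
  moreover have "(norm (Q *v z))\<^sup>2 = (norm z)\<^sup>2"
    unfolding power2_norm_eq_inner inner_transpose_matrix_vector[symmetric] Qz ..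
  moreover have "P *v w + Q *v z = w" by (simp only: Pw diff_add_cancel)
  ultimately show "(norm (P *v w))\<^sup>2 + (norm (transpose Q *v w))\<^sup>2 = (norm w)\<^sup>2"
    by (simp only: z_def)
qed

text \<open>A direction for \<open>X\<close> that also exists when \<open>X = 0\<close>: then any
  unit vector orthogonal to the columns serves, and there is one because the columns are fewer than
  the dimension. The central case is thus covered as well.\<close>

lemma exists_unit_vector_orthogonal_columns:
  fixes Q :: "real^'n^'m" and X :: "real^'m"
  assumes "CARD('n) < CARD('m)" and "transpose Q *v X = 0"
  obtains u where "norm u = 1" "transpose Q *v u = 0" "X = norm X *\<^sub>R u"
proof (cases "X = 0")
  case False
  show thesis
  proof (rule that)
    show "transpose Q *v ((1 / norm X) *\<^sub>R X) = 0"
      by (simp only: matrix_vector_mult_scaleR assms scaleR_zero_right)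
  qed (use False in simp_all)
next
  case True
  let ?C = "range (\<lambda>j. column j Q)"
  have "dim ?C \<le> CARD('n)" using dim_le_card'[of ?C] card_image_le[of UNIV "\<lambda>j. column j Q"] by simp
  hence "dim ?C < DIM(real^'m)" using assms(1) by simp
  then obtain x where x: "x \<noteq> 0" "\<And>y. y \<in> span ?C \<Longrightarrow> orthogonal x y"
    using orthogonal_to_subspace_exists by blast
  have "(transpose Q *v x) $ j = column j Q \<bullet> x" for j
    by (simp add: vector_matrix_mult_def column_def inner_vec_def mult.commute)
  moreover have "x \<bullet> column j Q = 0" for j
    using x(2)[of "column j Q"] by (simp add: orthogonal_def span_base)
  ultimately have "transpose Q *v x = 0" by (simp add: vec_eq_iff inner_commute del: transpose_matrix_vector)
  hence "transpose Q *v ((1 / norm x) *\<^sub>R x) = 0"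
    by (simp only: matrix_vector_mult_scaleR scaleR_zero_right)
  with x(1) True show thesis by (intro that[of "(1 / norm x) *\<^sub>R x"]) simp_all
qed

theorem corollary7p4:
  fixes B Q :: "((real, 'n::{finite,linorder}) vec, 'm::finite) vec"
    and R :: "((real, 'n) vec, 'n) vec"
    and P :: "real^'m^'m"
    and X :: "real^'m"
    and Y q :: "'\<omega> \<Rightarrow> real^'m"
    and M :: "'\<omega> measure"
    and \<sigma> \<tau> :: real
  assumes "CARD('n) < CARD('m)"
    and "rank B = CARD('n)"
    and "\<And>j. norm (column j B) = 1"
    and "thin_qr B Q R"
    and "P = mat 1 - Q ** transpose Q"
    and "X \<in> range ((*v) P)"
    and "0 < \<sigma>"
    and "prob_space M"
    and "distributed M lborel Y (\<lambda>y. ennreal (isotropic_normal_density \<sigma> y))"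
    and "\<And>\<omega>. q \<omega> = (1 / norm (X + Y \<omega>)) *\<^sub>R (X + Y \<omega>)"
    and "0 < \<tau>" and "\<tau> < 1"
  shows "(\<forall>\<omega>\<in>space M. \<tau> \<le> norm (P *v q \<omega>) \<longrightarrow>
            cond_number (append_column B (q \<omega>))
              \<le> cond_number B * ereal ((1 + sqrt (1 - \<tau>\<^sup>2)) / \<tau>))
       \<and> measure M {\<omega> \<in> space M. \<tau> \<le> norm (P *v q \<omega>)}
          = 1 - cdf (noncentral_F (CARD('m) - CARD('n)) (CARD('n)) ((norm X)\<^sup>2 / \<sigma>\<^sup>2))
                  (real CARD('n) * \<tau>\<^sup>2 / ((real CARD('m) - real CARD('n)) * (1 - \<tau>\<^sup>2)))"
proof -
  let ?m = "CARD('m)" and ?n = "CARD('n)"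
  let ?d = "?m - ?n"
  note less = assms(1) and \<sigma> = assms(7) and \<tau> = assms(11,12) and q = assms(10)
  have QQ: "transpose Q ** Q = mat 1" using assms(4) by (simp only: thin_qr_def)
  note proj = norm_orthogonal_projection[OF QQ assms(5)]
  have cond: "cond_number (append_column B (q \<omega>)) \<le> cond_number B * ereal ((1 + sqrt (1 - \<tau>\<^sup>2)) / \<tau>)"
    if "\<tau> \<le> norm (P *v q \<omega>)" for \<omega>
  proof -
    \<comment> \<open>At \<open>X + Y \<omega> = 0\<close> the vector \<open>q \<omega>\<close> is 0
      and the premise fails, so the bound holds at every point and not just almost surely.\<close>
    have "X + Y \<omega> \<noteq> 0" using that \<tau> q[of \<omega>] by auto
    hence n: "norm (q \<omega>) = 1" by (simp add: q)
    have "\<tau>\<^sup>2 \<le> (norm (P *v q \<omega>))\<^sup>2" using that \<tau> by (intro power_mono) auto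
    hence "\<tau>\<^sup>2 + (norm (transpose Q *v q \<omega>))\<^sup>2 \<le> 1"
      using proj(1)[of "q \<omega>"] unfolding n power_one by linarith
    with n \<tau> show ?thesis by (intro cond_number_append_column_le[OF assms(2,3,4)])
  qed

  \<comment> \<open>Coordinates of the perturbed vector in the adapted basis\<close>
  have "transpose Q *v X = 0" using assms(6) proj(2) by (metis imageE)
  from exists_unit_vector_orthogonal_columns[OF less this]
  obtain u where u: "norm u = 1" "transpose Q *v u = 0" "X = norm X *\<^sub>R u" .
  obtain e g where on: "\<And>i j. i < ?m \<Longrightarrow> j < ?m \<Longrightarrow> e i \<bullet> e j = (if i = j then 1 else 0)"
    and e0: "e 0 = u" and g: "bij_betw g {..<?n} (UNIV :: 'n set)"
    and eg: "\<And>i. i < ?n \<Longrightarrow> e (?d + i) = column (g i) Q"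
    using orthonormal_basis_adapted[OF less QQ u(1,2)] by blast
  define nc where "nc = (norm X)\<^sup>2 / \<sigma>\<^sup>2"
  \<comment> \<open>At \<open>Z \<omega>\<close>, \<open>U\<close> and \<open>V\<close> are the
    squared norms, divided by \<open>\<sigma>\<^sup>2\<close>, of the components of
    \<open>X + Y \<omega>\<close> in the ranges of \<open>P\<close> and \<open>Q\<close>.\<close>
  define U where "U z = (\<Sum>i<?d. ((if i = 0 then sqrt nc else 0) + z i)\<^sup>2)" for z :: "nat \<Rightarrow> real"
  define V where "V z = (\<Sum>i<?n. (z (?d + i))\<^sup>2)" for z :: "nat \<Rightarrow> real"
  define Z where "Z \<omega> = (\<lambda>i\<in>{..<?m}. (e i \<bullet> Y \<omega>) / \<sigma>)" for \<omega>
  have nc: "\<sigma> * sqrt nc = norm X" using \<sigma> by (simp add: nc_def real_sqrt_divide)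
  have eX: "e i \<bullet> X = (if i = 0 then norm X else 0)" if "i < ?m" for i
    using on[OF that, of 0] less by (subst u(3)) (auto simp: e0)
  have coord: "e i \<bullet> (X + Y \<omega>) = \<sigma> * ((if i = 0 then sqrt nc else 0) + Z \<omega> i)" if "i < ?m" for i \<omega>
    using that \<sigma> nc by (auto simp: Z_def inner_add_right eX distrib_left)
  have normQ: "(norm (transpose Q *v (X + Y \<omega>)))\<^sup>2 = \<sigma>\<^sup>2 * V (Z \<omega>)" for \<omega>
  proof -
    have "(norm (transpose Q *v (X + Y \<omega>)))\<^sup>2 = (\<Sum>j\<in>UNIV. (column j Q \<bullet> (X + Y \<omega>))\<^sup>2)"
      unfolding power2_norm_eq_inner
      by (simp add: inner_vec_def vector_matrix_mult_def column_def mult.commute power2_eq_square)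
    also have "\<dots> = (\<Sum>i<?n. (column (g i) Q \<bullet> (X + Y \<omega>))\<^sup>2)"
      by (rule sum.reindex_bij_betw[OF g, symmetric])
    also have "\<dots> = (\<Sum>i<?n. \<sigma>\<^sup>2 * (Z \<omega> (?d + i))\<^sup>2)"
    proof (rule sum.cong)
      fix i assume "i \<in> {..<?n}"
      \<comment> \<open>Since \<open>?d\<close> is positive, the shifted index 0 never belongs to a
        column of \<open>Q\<close>, which is why \<open>V\<close> is central.\<close>
      hence "?d + i < ?m" "?d + i \<noteq> 0" "i < ?n" using less by auto
      thus "(column (g i) Q \<bullet> (X + Y \<omega>))\<^sup>2 = \<sigma>\<^sup>2 * (Z \<omega> (?d + i))\<^sup>2"
        using coord[of "?d + i" \<omega>] eg[of i] by (simp only: if_False add_0_left power_mult_distrib)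
    qed simp
    finally show ?thesis by (simp add: V_def sum_distrib_left)
  qed
  have normX: "(norm (X + Y \<omega>))\<^sup>2 = \<sigma>\<^sup>2 * (U (Z \<omega>) + V (Z \<omega>))" for \<omega>
  proof -
    let ?h = "\<lambda>i. (if i = 0 then sqrt nc else 0) + Z \<omega> i"
    have "(norm (X + Y \<omega>))\<^sup>2 = (\<Sum>i<?m. (e i \<bullet> (X + Y \<omega>))\<^sup>2)"
      using orthonormal_parseval[of e "X + Y \<omega>"] on by simp
    also have "\<dots> = (\<Sum>i<?m. \<sigma>\<^sup>2 * (?h i)\<^sup>2)"
      by (intro sum.cong refl) (simp only: coord lessThan_iff power_mult_distrib)
    also have "\<dots> = \<sigma>\<^sup>2 * (\<Sum>i<?m. (?h i)\<^sup>2)" by (simp only: sum_distrib_left)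
    also have "{..<?m} = {..<?d} \<union> {?d..<?m}" by auto
    also have "(\<Sum>i\<in>{..<?d} \<union> {?d..<?m}. (?h i)\<^sup>2) = U (Z \<omega>) + (\<Sum>i=?d..<?m. (?h i)\<^sup>2)"
      unfolding U_def by (rule sum.union_disjoint) auto
    also have "(\<Sum>i=?d..<?m. (?h i)\<^sup>2) = V (Z \<omega>)"
      unfolding V_def
      by (rule sum.reindex_bij_witness[of _ "\<lambda>i. ?d + i" "\<lambda>i. i - ?d"]) (use less in auto)
    finally show ?thesis .
  qed
  \<comment> \<open>The first conjunct expresses \<open>X + Y \<omega> \<noteq> 0\<close>. At 0 the
    second one would hold trivially, whereas \<open>q \<omega> = 0\<close> violates the left
    side.\<close>
  have event: "\<tau> \<le> norm (P *v q \<omega>) \<longleftrightarrow> 0 < U (Z \<omega>) + V (Z \<omega>) \<and> \<tau>\<^sup>2 * (U (Z \<omega>) + V (Z \<omega>)) \<le> U (Z \<omega>)" for \<omega>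
  proof (cases "X + Y \<omega> = 0")
    case True
    hence "U (Z \<omega>) + V (Z \<omega>) = 0" using normX[of \<omega>] \<sigma> by simp
    thus ?thesis using True \<tau> by (simp add: q)
  next
    case False
    let ?w = "X + Y \<omega>"
    have pos: "0 < norm ?w" using False by simp
    hence "0 < \<sigma>\<^sup>2 * (U (Z \<omega>) + V (Z \<omega>))" unfolding normX[symmetric] by (rule zero_less_power)
    hence "0 < U (Z \<omega>) + V (Z \<omega>)" by (rule zero_less_mult_pos) (use \<sigma> in simp)
    moreover have "(norm (P *v ?w))\<^sup>2 = \<sigma>\<^sup>2 * U (Z \<omega>)"
      using proj(1)[of ?w] unfolding normQ normX by (simp add: distrib_left)
    moreover have "\<tau> \<le> norm (P *v q \<omega>) \<longleftrightarrow> \<tau> * norm ?w \<le> norm (P *v ?w)"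
    proof -
      have "norm (P *v q \<omega>) = norm (P *v ?w) / norm ?w"
        unfolding q matrix_vector_mult_scaleR norm_scaleR by simp
      thus ?thesis using pos by (simp only: pos_le_divide_eq)
    qed
    moreover have "\<dots> \<longleftrightarrow> (\<tau> * norm ?w)\<^sup>2 \<le> (norm (P *v ?w))\<^sup>2"
      using \<tau> by (simp add: power2_le_iff_abs_le abs_mult)
    moreover have "(\<tau> * norm ?w)\<^sup>2 = \<sigma>\<^sup>2 * (\<tau>\<^sup>2 * (U (Z \<omega>) + V (Z \<omega>)))"
      by (simp add: power_mult_distrib normX)
    ultimately show ?thesis using \<sigma> by (simp add: mult_le_cancel_left_pos)
  qed

  \<comment> \<open>Law of the coordinates and probability of the event\<close>
  interpret prob_space M by (rule assms(8))
  have Y: "Y \<in> M \<rightarrow>\<^sub>M lborel" using assms(9) by (rule distributed_measurable)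
  have "distr M (\<Pi>\<^sub>M i\<in>{..<?m}. borel) Z = distr (distr M lborel Y) (\<Pi>\<^sub>M i\<in>{..<?m}. borel)
      (\<lambda>y. \<lambda>i\<in>{..<?m}. (e i \<bullet> y) / \<sigma>)"
    by (subst distr_distr[OF _ Y]) (auto simp: Z_def[abs_def] comp_def intro!: measurable_restrict)
  also have "\<dots> = std_normal_vector ?m"
    unfolding distributed_distr_eq_density[OF assms(9)] by (rule distr_isotropic_normal[OF \<sigma> on])
  finally have distr_Z: "distr M (\<Pi>\<^sub>M i\<in>{..<?m}. borel) Z = std_normal_vector ?m" .
  have Z: "Z \<in> M \<rightarrow>\<^sub>M (\<Pi>\<^sub>M i\<in>{..<?m}. borel)"
    unfolding Z_def[abs_def] using Y by (intro measurable_restrict) simp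
  have dm: "?d + ?n = ?m" using less by simp
  have UV: "(\<lambda>z. (U z, V z)) \<in> (\<Pi>\<^sub>M i\<in>{..<?m}. borel) \<rightarrow>\<^sub>M borel \<Otimes>\<^sub>M borel"
    unfolding U_def V_def using less
    by (intro measurable_Pair borel_measurable_sum borel_measurable_power borel_measurable_add
      measurable_const measurable_component_singleton) auto
  let ?E = "{(u, v). 0 < u + v \<and> \<tau>\<^sup>2 * (u + v) \<le> u} :: (real \<times> real) set"
  have "{p \<in> space (borel \<Otimes>\<^sub>M borel). case p of (u, v) \<Rightarrow> 0 < u + v \<and> \<tau>\<^sup>2 * (u + v) \<le> u}
      \<in> sets (borel \<Otimes>\<^sub>M borel :: (real \<times> real) measure)" by measurable
  hence E: "?E \<in> sets (borel \<Otimes>\<^sub>M borel)" by (simp add: space_pair_measure)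
  have "noncentral_chi_square ?d nc \<Otimes>\<^sub>M chi_square ?n
      = distr (distr M (\<Pi>\<^sub>M i\<in>{..<?m}. borel) Z) (borel \<Otimes>\<^sub>M borel) (\<lambda>z. (U z, V z))"
    using distr_std_normal_vector_chi_squares[of ?d ?n nc] by (simp only: distr_Z dm U_def V_def)
  also have "\<dots> = distr M (borel \<Otimes>\<^sub>M borel) (\<lambda>\<omega>. (U (Z \<omega>), V (Z \<omega>)))"
    by (simp only: distr_distr[OF UV Z] comp_def)
  finally have "measure (noncentral_chi_square ?d nc \<Otimes>\<^sub>M chi_square ?n) ?E
      = measure M ((\<lambda>\<omega>. (U (Z \<omega>), V (Z \<omega>))) -` ?E \<inter> space M)"
    using measure_distr[OF measurable_compose[OF Z UV] E] by (simp only:)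
  also have "(\<lambda>\<omega>. (U (Z \<omega>), V (Z \<omega>))) -` ?E \<inter> space M = {\<omega> \<in> space M. \<tau> \<le> norm (P *v q \<omega>)}"
    using event by auto
  finally have "measure M {\<omega> \<in> space M. \<tau> \<le> norm (P *v q \<omega>)}
      = measure (noncentral_chi_square ?d nc \<Otimes>\<^sub>M chi_square ?n) ?E" by (rule sym)
  also have "\<dots> = 1 - cdf (noncentral_F ?d ?n nc) (real ?n * \<tau>\<^sup>2 / (real ?d * (1 - \<tau>\<^sup>2)))"
    using less \<tau> by (intro one_minus_cdf_noncentral_F) auto
  also have "real ?d = real ?m - real ?n" using less by simp
  finally show ?thesis using cond by (simp only: nc_def) blast
qed

end
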